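(* Let $\varphi$ and $\psi$ be bounded analytic functions on the open unit disc $\mathbb{U}$. Suppose $\varphi$ is a covering map with $\partial\varphi(\mathbb{U})$ a union of nondegenerate continua. Then $T_\varphi\propto T_\psi$ if and only if $\psi(\mathbb{U})\subset\varphi(\mathbb{U})$.
   Context: $\mathbb{U}$ is the open unit disc in $\mathbb{C}$ and $H^2$ is the Hardy space of $\mathbb{U}$. For a bounded analytic function $\varphi$ on $\mathbb{U}$, $T_\varphi:H^2\to H^2$ is the analytic Toeplitz operator $T_\varphi h=\varphi h$. For bounded linear operators $A,B$ on a Hilbert space $\mathcal{H}$, $A\propto B$ means that there is a nonzero bounded linear operator $X$ on $\mathcal{H}$ with $XA=BX$. "$\varphi$ is a covering map" means that $\varphi:\mathbb{U}\to\varphi(\mathbb{U})$ is a holomorphic (unbranched, topological) covering map of the domain $\varphi(\mathbb{U})$. A nondegenerate continuum is a compact connected set with more than one point; $\partial$ denotes the boundary in $\mathbb{C}$. *)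

theory Defs
  imports "HOL-Complex_Analysis.Complex_Analysis"
begin

section \<open>Complex Hilbert spaces and intertwining\<close>

text \<open>
  A complex Hilbert space is represented as a complete real inner product space with a compatible
  complex scalar multiplication satisfying \<open>norm (c x) = |c| norm x\<close>.  Here \<open>inner\<close> is the real
  part of the complex inner product; by polarisation, the latter is
  \<open>inner x y + \<i> inner x (\<i> y)\<close> (linear in \<open>x\<close>, conjugate linear in \<open>y\<close>).
\<close>

class complex_hilbert_space = real_inner + complete_space +
  fixes scaleC :: "complex \<Rightarrow> 'a \<Rightarrow> 'a" (infixr \<open>*\<^sub>C\<close> 75)
  assumes scaleC_add_right: "c *\<^sub>C (x + y) = c *\<^sub>C x + c *\<^sub>C y"
    and scaleC_add_left: "(c + d) *\<^sub>C x = c *\<^sub>C x + d *\<^sub>C x"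
    and scaleC_scaleC: "c *\<^sub>C d *\<^sub>C x = (c * d) *\<^sub>C x"
    and scaleC_of_real: "complex_of_real r *\<^sub>C x = r *\<^sub>R x"
    and norm_scaleC: "norm (c *\<^sub>C x) = cmod c * norm x"

definition bounded_clinear :: "('a::complex_hilbert_space \<Rightarrow> 'b::complex_hilbert_space) \<Rightarrow> bool"
  where "bounded_clinear X \<longleftrightarrow> bounded_linear X \<and> (\<forall>c x. X (c *\<^sub>C x) = c *\<^sub>C X x)"

definition intertwines ::
    "('a::complex_hilbert_space \<Rightarrow> 'a) \<Rightarrow> ('a \<Rightarrow> 'a) \<Rightarrow> bool" (infix \<open>\<propto>\<close> 50)
  where "A \<propto> B \<longleftrightarrow> (\<exists>X. bounded_clinear X \<and> X \<noteq> (\<lambda>_. 0) \<and> X \<circ> A = B \<circ> X)"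


section \<open>The Hardy space of the unit disc\<close>

definition maclaurin_coeff :: "(complex \<Rightarrow> complex) \<Rightarrow> nat \<Rightarrow> complex"
  where "maclaurin_coeff f n = (deriv ^^ n) f 0 / fact n"

text \<open>
  The holomorphic functions on the disc with square-summable Maclaurin coefficients.  The value
  outside the disc is normalised to \<open>0\<close>, so that equality in the type is equality on the disc.
\<close>

definition hardy2_set :: "(complex \<Rightarrow> complex) set"
  where "hardy2_set = {f. f holomorphic_on ball 0 1 \<and> (\<forall>z. z \<notin> ball 0 1 \<longrightarrow> f z = 0) \<and>
                          summable (\<lambda>n. (cmod (maclaurin_coeff f n))\<^sup>2)}"

lemma maclaurin_coeff_0: "maclaurin_coeff (\<lambda>_. 0) n = 0"
  by (simp add: maclaurin_coeff_def)

lemma maclaurin_coeff_add: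
  assumes "f holomorphic_on ball 0 1" "g holomorphic_on ball 0 1"
  shows "maclaurin_coeff (\<lambda>z. f z + g z) n = maclaurin_coeff f n + maclaurin_coeff g n"
  using higher_deriv_add[OF assms, of 0 n] by (simp add: maclaurin_coeff_def add_divide_distrib)

lemma maclaurin_coeff_cmult:
  assumes "f holomorphic_on ball 0 1"
  shows "maclaurin_coeff (\<lambda>z. c * f z) n = c * maclaurin_coeff f n"
  using higher_deriv_cmult[OF assms, of 0 n c] by (simp add: maclaurin_coeff_def)

lemma maclaurin_sums:
  assumes "f holomorphic_on ball 0 1" "z \<in> ball 0 1"
  shows "(\<lambda>n. maclaurin_coeff f n * z ^ n) sums f z"
  using holomorphic_power_series[OF assms] by (simp add: maclaurin_coeff_def)

lemma summable_sq_add: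
  fixes a b :: "nat \<Rightarrow> complex"
  assumes "summable (\<lambda>n. (cmod (a n))\<^sup>2)" "summable (\<lambda>n. (cmod (b n))\<^sup>2)"
  shows "summable (\<lambda>n. (cmod (a n + b n))\<^sup>2)"
proof (rule summable_comparison_test')
  show "summable (\<lambda>n. 2 * (cmod (a n))\<^sup>2 + 2 * (cmod (b n))\<^sup>2)"
    using assms by (intro summable_add summable_mult)
  fix n
  have "(cmod (a n + b n))\<^sup>2 \<le> (cmod (a n) + cmod (b n))\<^sup>2"
    by (intro power_mono norm_triangle_ineq) auto
  also have "\<dots> \<le> 2 * (cmod (a n))\<^sup>2 + 2 * (cmod (b n))\<^sup>2"
    using sum_squares_bound[of "cmod (a n)" "cmod (b n)"] by (simp add: power2_sum)
  finally show "norm ((cmod (a n + b n))\<^sup>2) \<le> 2 * (cmod (a n))\<^sup>2 + 2 * (cmod (b n))\<^sup>2" by simp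
qed

lemma summable_sq_cmult:
  fixes a :: "nat \<Rightarrow> complex"
  assumes "summable (\<lambda>n. (cmod (a n))\<^sup>2)"
  shows "summable (\<lambda>n. (cmod (c * a n))\<^sup>2)"
  using summable_mult[OF assms, of "(cmod c)\<^sup>2"] by (simp add: norm_mult power_mult_distrib)

lemma summable_sq_inner:
  fixes a b :: "nat \<Rightarrow> complex"
  assumes "summable (\<lambda>n. (cmod (a n))\<^sup>2)" "summable (\<lambda>n. (cmod (b n))\<^sup>2)"
  shows "summable (\<lambda>n. inner (a n) (b n))"
proof (rule summable_comparison_test')
  show "summable (\<lambda>n. (cmod (a n))\<^sup>2 + (cmod (b n))\<^sup>2)"
    using assms by (intro summable_add)
  fix n
  have "\<bar>inner (a n) (b n)\<bar> \<le> cmod (a n) * cmod (b n)"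
    by (rule Cauchy_Schwarz_ineq2)
  also have "\<dots> \<le> (cmod (a n))\<^sup>2 + (cmod (b n))\<^sup>2"
    using sum_squares_bound[of "cmod (a n)" "cmod (b n)"]
      mult_nonneg_nonneg[OF norm_ge_zero[of "a n"] norm_ge_zero[of "b n"]]
    by linarith
  finally show "norm (inner (a n) (b n)) \<le> (cmod (a n))\<^sup>2 + (cmod (b n))\<^sup>2" by simp
qed

lemma hardy2_set_0: "(\<lambda>_. 0) \<in> hardy2_set"
  by (simp add: hardy2_set_def maclaurin_coeff_0)

lemma hardy2_set_add: "f \<in> hardy2_set \<Longrightarrow> g \<in> hardy2_set \<Longrightarrow> (\<lambda>z. f z + g z) \<in> hardy2_set"
  by (auto simp: hardy2_set_def maclaurin_coeff_add intro!: holomorphic_intros summable_sq_add)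

lemma hardy2_set_cmult: "f \<in> hardy2_set \<Longrightarrow> (\<lambda>z. c * f z) \<in> hardy2_set"
  by (auto simp: hardy2_set_def maclaurin_coeff_cmult intro!: holomorphic_intros summable_sq_cmult)

typedef hardy2 = hardy2_set
  morphisms hardy2_fun Abs_hardy2
  using hardy2_set_0 by blast

setup_lifting type_definition_hardy2

definition hardy2_coeff :: "hardy2 \<Rightarrow> nat \<Rightarrow> complex"
  where "hardy2_coeff f = maclaurin_coeff (hardy2_fun f)"

lemma hardy2_fun_holomorphic: "hardy2_fun f holomorphic_on ball 0 1"
  using hardy2_fun[of f] by (simp add: hardy2_set_def)

lemma hardy2_summable: "summable (\<lambda>n. (cmod (hardy2_coeff f n))\<^sup>2)"
  using hardy2_fun[of f] by (simp add: hardy2_set_def hardy2_coeff_def)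

lemma hardy2_sums: "z \<in> ball 0 1 \<Longrightarrow> (\<lambda>n. hardy2_coeff f n * z ^ n) sums hardy2_fun f z"
  using maclaurin_sums[OF hardy2_fun_holomorphic] by (simp add: hardy2_coeff_def)

lemma hardy2_eqI:
  assumes "\<And>z. z \<in> ball 0 1 \<Longrightarrow> hardy2_fun f z = hardy2_fun g z"
  shows "f = g"
proof -
  have "hardy2_fun f z = hardy2_fun g z" for z
    using assms[of z] hardy2_fun[of f] hardy2_fun[of g]
    by (cases "z \<in> ball 0 1") (auto simp: hardy2_set_def)
  thus ?thesis by (metis ext hardy2_fun_inject)
qed

lemma hardy2_coeff_eqI:
  assumes "\<And>n. hardy2_coeff f n = hardy2_coeff g n"
  shows "f = g"
proof (rule hardy2_eqI)
  fix z :: complex assume "z \<in> ball 0 1"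
  with hardy2_sums[of z f] hardy2_sums[of z g] show "hardy2_fun f z = hardy2_fun g z"
    using assms sums_unique2 by fastforce
qed

text \<open>Every square-summable sequence is the coefficient sequence of an element.\<close>

lemma hardy2_coeff_surj:
  fixes a :: "nat \<Rightarrow> complex"
  assumes a: "summable (\<lambda>n. (cmod (a n))\<^sup>2)"
  obtains f where "hardy2_coeff f = a"
proof -
  have "Bseq (\<lambda>n. (cmod (a n))\<^sup>2)"
    using summable_LIMSEQ_zero[OF a] by (meson convergentI convergent_imp_Bseq)
  then obtain K where K: "\<And>n. (cmod (a n))\<^sup>2 \<le> K"
    by (auto simp: Bseq_def)
  have bd: "cmod (a n) \<le> 1 + K" for n
  proof -
    have "cmod (a n) \<le> 1 + (cmod (a n))\<^sup>2"
      using sum_squares_bound[of "cmod (a n)" 1] norm_ge_zero[of "a n"] by (simp del: norm_ge_zero)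
    thus ?thesis using K[of n] by linarith
  qed
  have rad: "fps_conv_radius (Abs_fps a) \<ge> 1"
    unfolding fps_conv_radius_def fps_nth_Abs_fps
  proof (rule conv_radius_geI_ex')
    fix r :: real assume r: "0 < r" "ereal r < 1"
    show "summable (\<lambda>n. a n * of_real r ^ n)"
    proof (rule summable_comparison_test')
      show "summable (\<lambda>n. (1 + K) * r ^ n)"
        using r by (intro summable_mult summable_geometric) auto
      show "norm (a n * of_real r ^ n) \<le> (1 + K) * r ^ n" for n
        using bd[of n] r by (auto simp: norm_mult norm_power intro!: mult_right_mono)
    qed
  qed
  define F where "F = (\<lambda>z::complex. if z \<in> ball 0 1 then eval_fps (Abs_fps a) z else 0)"
  have "eval_fps (Abs_fps a) has_fps_expansion Abs_fps a"
    using less_le_trans[OF _ rad, of 0] by (intro eval_fps_has_fps_expansion) simp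
  moreover have "eventually (\<lambda>z. eval_fps (Abs_fps a) z = F z) (nhds 0)"
    using eventually_nhds_in_open[of "ball (0::complex) 1" 0]
    by (auto simp: F_def elim!: eventually_mono)
  ultimately have "F has_fps_expansion Abs_fps a"
    by (auto simp: has_fps_expansion_def elim: eventually_elim2)
  hence coeff: "maclaurin_coeff F n = a n" for n
    using fps_nth_fps_expansion[of F "Abs_fps a" n] by (simp add: maclaurin_coeff_def)
  have "eval_fps (Abs_fps a) holomorphic_on ball 0 1"
  proof (rule holomorphic_on_eval_fps, rule subsetI)
    fix z :: complex assume "z \<in> ball 0 1"
    hence "ereal (norm z) < 1" by simp
    from less_le_trans[OF this rad] show "z \<in> eball 0 (fps_conv_radius (Abs_fps a))"
      by (simp add: in_eball_iff)
  qed
  hence "F holomorphic_on ball 0 1"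
    by (rule holomorphic_transform) (auto simp: F_def)
  hence "F \<in> hardy2_set"
    using a unfolding hardy2_set_def mem_Collect_eq coeff by (simp add: F_def)
  hence "hardy2_coeff (Abs_hardy2 F) = a"
    by (auto simp: hardy2_coeff_def Abs_hardy2_inverse coeff)
  thus ?thesis by (rule that)
qed

instantiation hardy2 :: real_vector
begin

lift_definition zero_hardy2 :: hardy2 is "\<lambda>_. 0" by (rule hardy2_set_0)
lift_definition plus_hardy2 :: "hardy2 \<Rightarrow> hardy2 \<Rightarrow> hardy2" is "\<lambda>f g z. f z + g z"
  by (rule hardy2_set_add)
lift_definition scaleR_hardy2 :: "real \<Rightarrow> hardy2 \<Rightarrow> hardy2" is "\<lambda>r f z. of_real r * f z"
  by (rule hardy2_set_cmult)
lift_definition uminus_hardy2 :: "hardy2 \<Rightarrow> hardy2" is "\<lambda>f z. - f z"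
  using hardy2_set_cmult[of _ "-1"] by simp
definition minus_hardy2 :: "hardy2 \<Rightarrow> hardy2 \<Rightarrow> hardy2" where "minus_hardy2 f g = f + (- g)"

instance
  by standard (unfold minus_hardy2_def, (transfer, auto simp: algebra_simps)+)

end

lift_definition hardy2_scaleC :: "complex \<Rightarrow> hardy2 \<Rightarrow> hardy2" is "\<lambda>c f z. c * f z"
  by (rule hardy2_set_cmult)

lemma hardy2_coeff_0: "hardy2_coeff 0 n = 0"
  by (simp add: hardy2_coeff_def zero_hardy2.rep_eq maclaurin_coeff_0)

lemma hardy2_coeff_add: "hardy2_coeff (f + g) n = hardy2_coeff f n + hardy2_coeff g n"
  by (simp add: hardy2_coeff_def plus_hardy2.rep_eq maclaurin_coeff_add hardy2_fun_holomorphic)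

lemma hardy2_coeff_scaleC: "hardy2_coeff (hardy2_scaleC c f) n = c * hardy2_coeff f n"
  by (simp add: hardy2_coeff_def hardy2_scaleC.rep_eq maclaurin_coeff_cmult hardy2_fun_holomorphic)

lemma hardy2_scaleR_conv: "r *\<^sub>R f = hardy2_scaleC (of_real r) f"
  by transfer simp

lemma hardy2_coeff_scaleR: "hardy2_coeff (r *\<^sub>R f) n = of_real r * hardy2_coeff f n"
  by (simp add: hardy2_scaleR_conv hardy2_coeff_scaleC)

lemma hardy2_coeff_diff: "hardy2_coeff (f - g) n = hardy2_coeff f n - hardy2_coeff g n"
  using hardy2_coeff_add[of "f - g" g n] by simp

instantiation hardy2 :: real_inner
begin

definition inner_hardy2 :: "hardy2 \<Rightarrow> hardy2 \<Rightarrow> real"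
  where "inner f g = (\<Sum>n. Re (hardy2_coeff f n * cnj (hardy2_coeff g n)))"
definition norm_hardy2 :: "hardy2 \<Rightarrow> real"
  where "norm f = sqrt (\<Sum>n. (cmod (hardy2_coeff f n))\<^sup>2)"
definition sgn_hardy2 :: "hardy2 \<Rightarrow> hardy2" where "sgn_hardy2 f = inverse (norm f) *\<^sub>R f"
definition dist_hardy2 :: "hardy2 \<Rightarrow> hardy2 \<Rightarrow> real" where "dist_hardy2 f g = norm (f - g)"
definition uniformity_hardy2 :: "(hardy2 \<times> hardy2) filter"
  where "uniformity_hardy2 = (INF e\<in>{0<..}. principal {(f, g). dist f g < e})"
definition open_hardy2 :: "hardy2 set \<Rightarrow> bool"
  where "open_hardy2 U \<longleftrightarrow> (\<forall>x\<in>U. eventually (\<lambda>(x', y). x' = x \<longrightarrow> y \<in> U) uniformity)"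

lemma inner_hardy2_alt: "inner f g = (\<Sum>n. inner (hardy2_coeff f n) (hardy2_coeff g n))"
  by (simp add: inner_hardy2_def inner_complex_def)

lemma inner_self_hardy2: "inner f f = (\<Sum>n. (cmod (hardy2_coeff f n))\<^sup>2)"
  by (simp add: inner_hardy2_alt dot_square_norm)

lemma summable_inner_hardy2: "summable (\<lambda>n. inner (hardy2_coeff f n) (hardy2_coeff g n))"
  by (intro summable_sq_inner hardy2_summable)

instance
proof
  fix f g h :: hardy2 and r :: real
  show "inner f g = inner g f"
    by (simp add: inner_hardy2_alt inner_commute)
  show "inner (f + g) h = inner f h + inner g h"
    by (simp add: inner_hardy2_alt hardy2_coeff_add inner_add_left suminf_add summable_inner_hardy2)
  have "inner (hardy2_coeff (r *\<^sub>R f) n) w = r * inner (hardy2_coeff f n) w" for n w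
    by (simp add: hardy2_coeff_scaleR flip: scaleR_conv_of_real)
  thus "inner (r *\<^sub>R f) g = r * inner f g"
    by (simp add: inner_hardy2_alt suminf_mult summable_inner_hardy2)
  show "0 \<le> inner f f"
    by (simp add: inner_self_hardy2 suminf_nonneg hardy2_summable)
  show "inner f f = 0 \<longleftrightarrow> f = 0"
  proof
    assume "inner f f = 0"
    hence "hardy2_coeff f n = 0" for n
      using suminf_eq_zero_iff[OF hardy2_summable[of f]] by (simp add: inner_self_hardy2)
    thus "f = 0" by (intro hardy2_coeff_eqI) (simp add: hardy2_coeff_0)
  qed (simp add: inner_self_hardy2 hardy2_coeff_0)
  show "norm f = sqrt (inner f f)"
    by (simp add: inner_self_hardy2 norm_hardy2_def)
qed (simp_all add: sgn_hardy2_def dist_hardy2_def uniformity_hardy2_def open_hardy2_def)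

end

lemma hardy2_partial_sum_le: "(\<Sum>n<N. (cmod (hardy2_coeff f n))\<^sup>2) \<le> (norm f)\<^sup>2"
proof -
  have "(norm f)\<^sup>2 = (\<Sum>n. (cmod (hardy2_coeff f n))\<^sup>2)"
    by (simp add: norm_hardy2_def suminf_nonneg hardy2_summable)
  thus ?thesis by (simp add: sum_le_suminf hardy2_summable)
qed

lemma hardy2_norm_leI:
  assumes "\<And>N. (\<Sum>n<N. (cmod (hardy2_coeff f n))\<^sup>2) \<le> C\<^sup>2" "C \<ge> 0"
  shows "norm f \<le> C"
proof -
  have "(\<Sum>n. (cmod (hardy2_coeff f n))\<^sup>2) \<le> C\<^sup>2"
    using assms by (intro suminf_le_const hardy2_summable) auto
  thus ?thesis using assms(2) by (simp add: norm_hardy2_def real_le_lsqrt suminf_nonneg hardy2_summable)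
qed

lemma hardy2_coeff_le_norm: "cmod (hardy2_coeff f n) \<le> norm f"
proof -
  have "(cmod (hardy2_coeff f n))\<^sup>2 \<le> (\<Sum>k<Suc n. (cmod (hardy2_coeff f k))\<^sup>2)"
    by (simp add: sum_nonneg)
  also have "\<dots> \<le> (norm f)\<^sup>2" by (rule hardy2_partial_sum_le)
  finally show ?thesis by (rule power2_le_imp_le) simp
qed

instance hardy2 :: complete_space
proof
  fix X :: "nat \<Rightarrow> hardy2" assume X: "Cauchy X"
  have "Cauchy (\<lambda>k. hardy2_coeff (X k) n)" for n
    unfolding Cauchy_def
  proof (intro allI impI)
    fix e :: real assume "e > 0"
    with X obtain M where "\<forall>k\<ge>M. \<forall>m\<ge>M. dist (X k) (X m) < e" by (auto simp: Cauchy_def)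
    moreover have "dist (hardy2_coeff (X k) n) (hardy2_coeff (X m) n) \<le> dist (X k) (X m)" for k m
      using hardy2_coeff_le_norm[of "X k - X m" n] by (simp add: dist_norm hardy2_coeff_diff)
    ultimately show
      "\<exists>M. \<forall>k\<ge>M. \<forall>m\<ge>M. dist (hardy2_coeff (X k) n) (hardy2_coeff (X m) n) < e"
      by (meson le_less_trans)
  qed
  hence "\<exists>b. (\<lambda>k. hardy2_coeff (X k) n) \<longlonglongrightarrow> b" for n
    by (simp add: Cauchy_convergent_iff convergent_def)
  then obtain b where b: "\<And>n. (\<lambda>k. hardy2_coeff (X k) n) \<longlonglongrightarrow> b n" by metis
  have tail: "(\<Sum>n<N. (cmod (hardy2_coeff (X k) n - b n))\<^sup>2) \<le> e\<^sup>2"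
    if M: "\<forall>k\<ge>M. \<forall>m\<ge>M. dist (X k) (X m) < e" and k: "k \<ge> M" for M e k N
  proof (rule LIMSEQ_le_const2)
    show "(\<lambda>m. \<Sum>n<N. (cmod (hardy2_coeff (X k) n - hardy2_coeff (X m) n))\<^sup>2)
            \<longlonglongrightarrow> (\<Sum>n<N. (cmod (hardy2_coeff (X k) n - b n))\<^sup>2)"
      by (intro tendsto_intros b)
    have "(\<Sum>n<N. (cmod (hardy2_coeff (X k) n - hardy2_coeff (X m) n))\<^sup>2) \<le> e\<^sup>2" if "m \<ge> M" for m
    proof -
      have "(norm (X k - X m))\<^sup>2 \<le> e\<^sup>2"
        using M k that by (intro power_mono) (auto simp: dist_norm intro: less_imp_le)
      with hardy2_partial_sum_le[of "X k - X m" N] show ?thesis by (simp add: hardy2_coeff_diff)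
    qed
    thus "\<exists>M. \<forall>m\<ge>M. (\<Sum>n<N. (cmod (hardy2_coeff (X k) n - hardy2_coeff (X m) n))\<^sup>2) \<le> e\<^sup>2" by blast
  qed
  obtain M where M: "\<forall>k\<ge>M. \<forall>m\<ge>M. dist (X k) (X m) < 1"
    using X by (auto simp: Cauchy_def dest: spec[of _ 1])
  have "summable (\<lambda>n. (cmod (hardy2_coeff (X M) n - b n))\<^sup>2)"
  proof (rule bounded_imp_summable)
    show "(\<Sum>n\<le>N. (cmod (hardy2_coeff (X M) n - b n))\<^sup>2) \<le> 1\<^sup>2" for N
      using tail[OF M, of M "Suc N"] by (simp only: lessThan_Suc_atMost)
  qed auto
  from summable_sq_add[OF hardy2_summable[of "X M"] summable_sq_cmult[OF this, of "-1"]]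
  have "summable (\<lambda>n. (cmod (b n))\<^sup>2)" by simp
  then obtain g where g: "hardy2_coeff g = b" by (rule hardy2_coeff_surj)
  have "X \<longlonglongrightarrow> g"
  proof (rule metric_LIMSEQ_I)
    fix e :: real assume e: "e > 0"
    with X obtain M where M: "\<forall>k\<ge>M. \<forall>m\<ge>M. dist (X k) (X m) < e / 2"
      by (auto simp: Cauchy_def dest: spec[of _ "e / 2"])
    have "norm (X k - g) \<le> e / 2" if "k \<ge> M" for k
      using tail[OF M that] e by (intro hardy2_norm_leI) (auto simp: hardy2_coeff_diff g)
    thus "\<exists>M. \<forall>k\<ge>M. dist (X k) g < e"
      using e by (intro exI[of _ M]) (force simp: dist_norm)
  qed
  thus "convergent X" by (auto simp: convergent_def)
qed

instantiation hardy2 :: complex_hilbert_space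
begin

definition scaleC_hardy2 :: "complex \<Rightarrow> hardy2 \<Rightarrow> hardy2" where "scaleC_hardy2 = hardy2_scaleC"

instance
proof
  fix c d :: complex and f g :: hardy2 and r :: real
  show "c *\<^sub>C (f + g) = c *\<^sub>C f + c *\<^sub>C g"
    by (rule hardy2_eqI)
      (simp add: scaleC_hardy2_def hardy2_scaleC.rep_eq plus_hardy2.rep_eq algebra_simps)
  show "(c + d) *\<^sub>C f = c *\<^sub>C f + d *\<^sub>C f"
    by (rule hardy2_eqI)
      (simp add: scaleC_hardy2_def hardy2_scaleC.rep_eq plus_hardy2.rep_eq algebra_simps)
  show "c *\<^sub>C d *\<^sub>C f = (c * d) *\<^sub>C f"
    by (rule hardy2_eqI)
      (simp add: scaleC_hardy2_def hardy2_scaleC.rep_eq plus_hardy2.rep_eq algebra_simps)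
  show "complex_of_real r *\<^sub>C f = r *\<^sub>R f"
    by (simp add: scaleC_hardy2_def hardy2_scaleR_conv)
  show "norm (c *\<^sub>C f) = cmod c * norm f"
  proof -
    have "(\<Sum>n. (cmod (hardy2_coeff (c *\<^sub>C f) n))\<^sup>2) = (cmod c)\<^sup>2 * (\<Sum>n. (cmod (hardy2_coeff f n))\<^sup>2)"
      unfolding scaleC_hardy2_def hardy2_coeff_scaleC norm_mult power_mult_distrib
      by (rule suminf_mult[OF hardy2_summable])
    thus ?thesis unfolding norm_hardy2_def by (simp only: real_sqrt_mult real_sqrt_abs abs_norm_cancel)
  qed
qed

end

section \<open>Analytic Toeplitz operators\<close>

text \<open>
  \<open>Abs_hardy2\<close> is applied to an element of the Hardy space whenever \<open>\<phi>\<close> is holomorphic and bounded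
  on the disc; see \<open>hardy2_fun_toeplitz\<close> and \<open>bounded_clinear_toeplitz\<close> below.
\<close>

definition toeplitz :: "(complex \<Rightarrow> complex) \<Rightarrow> hardy2 \<Rightarrow> hardy2"
  where "toeplitz \<phi> h = Abs_hardy2 (\<lambda>z. if z \<in> ball 0 1 then \<phi> z * hardy2_fun h z else 0)"

lemma integral_cis_int:
  fixes k :: int
  assumes "k \<noteq> 0"
  shows "((\<lambda>t. cis (of_int k * t)) has_integral 0) {0..2 * pi}"
proof -
  define F where "F = (\<lambda>t::real. cis (of_int k * t) / (\<i> * of_int k))"
  have "(F has_vector_derivative cis (of_int k * t)) (at t within {0..2 * pi})" for t
    unfolding F_def cis_conv_exp using assms
    by (auto intro!: derivative_eq_intros has_vector_derivative_real_field simp: field_simps)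
  hence "((\<lambda>t. cis (of_int k * t)) has_integral (F (2 * pi) - F 0)) {0..2 * pi}"
    by (intro fundamental_theorem_of_calculus) auto
  moreover have "F (2 * pi) = F 0"
    using cis_multiple_2pi[of "of_int k"] by (simp add: F_def mult_ac)
  ultimately show ?thesis by simp
qed

lemma polynomial_parseval:
  fixes a :: "nat \<Rightarrow> complex"
  shows "((\<lambda>t. (cmod (\<Sum>n<N. a n * cis t ^ n))\<^sup>2) has_integral 2 * pi * (\<Sum>n<N. (cmod (a n))\<^sup>2))
           {0..2 * pi}"
proof -
  have expand: "(\<Sum>n<N. a n * cis t ^ n) * cnj (\<Sum>m<N. a m * cis t ^ m) =
          (\<Sum>n<N. \<Sum>m<N. (a n * cnj (a m)) * cis (of_int (int n - int m) * t))" for t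
  proof -
    have "cis t ^ n * cnj (cis t ^ m) = cis (of_int (int n - int m) * t)" for n m
      unfolding Complex.DeMoivre cis_cnj cis_mult by (simp add: left_diff_distrib)
    hence "a n * cis t ^ n * cnj (a m * cis t ^ m) =
             (a n * cnj (a m)) * cis (of_int (int n - int m) * t)" for n m
      by (metis complex_cnj_mult mult.assoc mult.left_commute)
    thus ?thesis by (simp only: cnj_sum sum_product)
  qed
  have "((\<lambda>t. (a n * cnj (a m)) * cis (of_int (int n - int m) * t)) has_integral
          (if m = n then of_real (2 * pi * (cmod (a n))\<^sup>2) else 0)) {0..2 * pi}" for n m
  proof (cases "m = n")
    case True
    have "((\<lambda>t. a n * cnj (a n)) has_integral (2 * pi - 0) *\<^sub>R (a n * cnj (a n))) {0..2 * pi}"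
      using has_integral_const_real[of "a n * cnj (a n)" 0 "2 * pi"] by simp
    with True show ?thesis by (simp add: complex_norm_square scaleR_conv_of_real del: of_real_power)
  next
    case False
    from has_integral_mult_right[OF integral_cis_int[of "int n - int m"], of "a n * cnj (a m)"] False
    show ?thesis by simp
  qed
  hence "((\<lambda>t. \<Sum>n<N. \<Sum>m<N. (a n * cnj (a m)) * cis (of_int (int n - int m) * t)) has_integral
          (\<Sum>n<N. \<Sum>m<N. if m = n then of_real (2 * pi * (cmod (a n))\<^sup>2) else 0)) {0..2 * pi}"
    by (intro has_integral_sum) auto
  hence "((\<lambda>t. of_real ((cmod (\<Sum>n<N. a n * cis t ^ n))\<^sup>2) :: complex) has_integral
          of_real (2 * pi * (\<Sum>n<N. (cmod (a n))\<^sup>2))) {0..2 * pi}"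
    unfolding complex_norm_square expand sum_distrib_left by simp
  from has_integral_Re[OF this] show ?thesis by simp
qed

lemma parseval_circle:
  assumes f: "f holomorphic_on ball 0 1" and r: "0 < r" "r < 1"
  shows "((\<lambda>n. (cmod (maclaurin_coeff f n * of_real r ^ n))\<^sup>2) sums
           (integral {0..2 * pi} (\<lambda>t. (cmod (f (of_real r * cis t)))\<^sup>2) / (2 * pi)))"
    and "(\<lambda>t. (cmod (f (of_real r * cis t)))\<^sup>2) integrable_on {0..2 * pi}"
proof -
  define a where "a n = maclaurin_coeff f n * of_real r ^ n" for n
  define P where "P N t = (\<Sum>n<N. a n * cis t ^ n)" for N t
  define g where "g t = f (of_real r * cis t)" for t
  define s where "s = (r + 1) / 2"
  have s: "0 < s" "r < s" "s < 1" using r by (auto simp: s_def)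
  have lim: "uniform_limit {0..2 * pi} P g sequentially"
  proof -
    have "summable (\<lambda>n. maclaurin_coeff f n * of_real s ^ n)"
      using maclaurin_sums[OF f, of "of_real s"] s by (auto simp: sums_iff)
    hence "summable (\<lambda>n. norm (maclaurin_coeff f n * of_real r ^ n))"
      by (rule powser_insidea) (use r s in auto)
    hence "summable (\<lambda>n. cmod (a n))" by (simp add: a_def)
    hence "uniform_limit {0..2 * pi} P (\<lambda>t. \<Sum>n. a n * cis t ^ n) sequentially"
      unfolding P_def by (intro Weierstrass_m_test) (auto simp: norm_mult norm_power)
    moreover have "(\<Sum>n. a n * cis t ^ n) = g t" for t
      using maclaurin_sums[OF f, of "of_real r * cis t"] r
      by (auto simp: sums_iff a_def g_def power_mult_distrib mult_ac norm_mult)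
    ultimately show ?thesis by simp
  qed
  have contP: "continuous_on {0..2 * pi} (P N)" for N
    unfolding P_def by (intro continuous_intros)
  hence "continuous_on {0..2 * pi} g"
    by (intro uniform_limit_theorem[OF _ lim]) auto
  hence "bounded (g ` {0..2 * pi})"
    by (intro compact_imp_bounded compact_continuous_image) auto
  have ulim: "uniform_limit {0..2 * pi} (\<lambda>N t. P N t * cnj (P N t)) (\<lambda>t. g t * cnj (g t)) sequentially"
  proof (rule uniform_lim_mult)
    show "uniform_limit {0..2 * pi} (\<lambda>N t. cnj (P N t)) (\<lambda>t. cnj (g t)) sequentially"
      by (rule bounded_linear.uniform_limit[OF bounded_linear_cnj lim])
    show "bounded ((\<lambda>t. cnj (g t)) ` {0..2 * pi})"
      using \<open>bounded (g ` _)\<close> by (auto simp: bounded_iff)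
  qed (use lim \<open>bounded (g ` _)\<close> in auto)
  have ulim': "uniform_limit {0..2 * pi} (\<lambda>N t. (cmod (P N t))\<^sup>2) (\<lambda>t. (cmod (g t))\<^sup>2) sequentially"
    using bounded_linear.uniform_limit[OF bounded_linear_Re ulim]
    by (simp add: complex_mult_cnj cmod_power2)
  obtain I J where IJ: "\<And>N. ((\<lambda>t. (cmod (P N t))\<^sup>2) has_integral I N) {0..2 * pi}"
      "((\<lambda>t. (cmod (g t))\<^sup>2) has_integral J) {0..2 * pi}" "I \<longlonglongrightarrow> J"
    by (rule uniform_limit_integral[OF ulim']) (auto intro!: continuous_intros contP)
  have "I N = 2 * pi * (\<Sum>n<N. (cmod (a n))\<^sup>2)" for N
    using IJ(1)[of N] polynomial_parseval[of a N] by (auto simp: P_def intro: has_integral_unique)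
  hence "(\<lambda>N. 2 * pi * (\<Sum>n<N. (cmod (a n))\<^sup>2)) \<longlonglongrightarrow> J"
    using IJ(3) by presburger
  from tendsto_divide[OF this tendsto_const[of "2 * pi"]]
  have "(\<lambda>N. \<Sum>n<N. (cmod (a n))\<^sup>2) \<longlonglongrightarrow> J / (2 * pi)" by simp
  moreover have "J = integral {0..2 * pi} (\<lambda>t. (cmod (f (of_real r * cis t)))\<^sup>2)"
    using IJ(2) by (simp add: g_def integral_unique)
  ultimately show "(\<lambda>n. (cmod (maclaurin_coeff f n * of_real r ^ n))\<^sup>2) sums
           (integral {0..2 * pi} (\<lambda>t. (cmod (f (of_real r * cis t)))\<^sup>2) / (2 * pi))"
    unfolding sums_def a_def by simp
  show "(\<lambda>t. (cmod (f (of_real r * cis t)))\<^sup>2) integrable_on {0..2 * pi}"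
    using IJ(2) by (auto simp: g_def)
qed

lemma multiplier_partial_sum_le:
  assumes \<phi>: "\<phi> holomorphic_on ball 0 1" and M: "\<And>z. z \<in> ball 0 1 \<Longrightarrow> cmod (\<phi> z) \<le> M"
    and h: "h \<in> hardy2_set"
  shows "(\<Sum>n<N. (cmod (maclaurin_coeff (\<lambda>z. \<phi> z * h z) n))\<^sup>2) \<le>
           M\<^sup>2 * (\<Sum>n. (cmod (maclaurin_coeff h n))\<^sup>2)"
proof -
  let ?g = "\<lambda>z. \<phi> z * h z"
  let ?A = "M\<^sup>2 * (\<Sum>n. (cmod (maclaurin_coeff h n))\<^sup>2)"
  have hh: "h holomorphic_on ball 0 1" and hs: "summable (\<lambda>n. (cmod (maclaurin_coeff h n))\<^sup>2)"
    using h by (auto simp: hardy2_set_def)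
  have gh: "?g holomorphic_on ball 0 1" using \<phi> hh by (intro holomorphic_intros)
  have "(\<Sum>n<N. (cmod (maclaurin_coeff ?g n * of_real r ^ n))\<^sup>2) \<le> ?A" if r: "0 < r" "r < 1" for r
  proof -
    let ?Ig = "integral {0..2 * pi} (\<lambda>t. (cmod (?g (of_real r * cis t)))\<^sup>2)"
    let ?Ih = "integral {0..2 * pi} (\<lambda>t. (cmod (h (of_real r * cis t)))\<^sup>2)"
    have "?Ig \<le> integral {0..2 * pi} (\<lambda>t. M\<^sup>2 * (cmod (h (of_real r * cis t)))\<^sup>2)"
    proof (rule integral_le)
      show "(\<lambda>t. (cmod (?g (of_real r * cis t)))\<^sup>2) integrable_on {0..2 * pi}"
        by (rule parseval_circle(2)[OF gh r])
      show "(\<lambda>t. M\<^sup>2 * (cmod (h (of_real r * cis t)))\<^sup>2) integrable_on {0..2 * pi}"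
        by (intro integrable_on_mult_right parseval_circle(2)[OF hh r])
      fix t
      have "cmod (\<phi> (of_real r * cis t)) \<le> M" using r by (intro M) (simp add: norm_mult)
      thus "(cmod (?g (of_real r * cis t)))\<^sup>2 \<le> M\<^sup>2 * (cmod (h (of_real r * cis t)))\<^sup>2"
        unfolding norm_mult power_mult_distrib by (intro mult_right_mono power_mono) simp_all
    qed
    hence I: "?Ig / (2 * pi) \<le> M\<^sup>2 * (?Ih / (2 * pi))"
      by (simp add: divide_right_mono)
    have "(\<Sum>n<N. (cmod (maclaurin_coeff ?g n * of_real r ^ n))\<^sup>2) \<le> ?Ig / (2 * pi)"
      unfolding sums_unique[OF parseval_circle(1)[OF gh r]]
      by (rule sum_le_suminf) (use parseval_circle(1)[OF gh r] in \<open>simp_all add: sums_iff\<close>)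
    moreover have "?Ih / (2 * pi) \<le> (\<Sum>n. (cmod (maclaurin_coeff h n))\<^sup>2)"
    proof (rule sums_le[OF _ parseval_circle(1)[OF hh r] summable_sums[OF hs]])
      show "(cmod (maclaurin_coeff h n * of_real r ^ n))\<^sup>2 \<le> (cmod (maclaurin_coeff h n))\<^sup>2" for n
        using r by (intro power_mono) (simp_all add: norm_mult norm_power power_le_one mult_left_le)
    qed
    hence "M\<^sup>2 * (?Ih / (2 * pi)) \<le> ?A" by (rule mult_left_mono) simp
    ultimately show ?thesis using I by (meson order.trans)
  qed
  hence "eventually (\<lambda>r. (\<Sum>n<N. (cmod (maclaurin_coeff ?g n * of_real r ^ n))\<^sup>2) \<le> ?A) (at_left 1)"
    using eventually_at_left_real[of 0 1] by (auto elim!: eventually_mono)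
  moreover have "((\<lambda>r. \<Sum>n<N. (cmod (maclaurin_coeff ?g n * of_real r ^ n))\<^sup>2) \<longlongrightarrow>
                   (\<Sum>n<N. (cmod (maclaurin_coeff ?g n * of_real 1 ^ n))\<^sup>2)) (at_left (1::real))"
    by (intro tendsto_intros)
  ultimately have "(\<Sum>n<N. (cmod (maclaurin_coeff ?g n * of_real 1 ^ n))\<^sup>2) \<le> ?A"
    by (intro tendsto_upperbound[of _ _ "at_left (1::real)"]) simp_all
  thus ?thesis by simp
qed

lemma multiplier_in_hardy2_set:
  assumes \<phi>: "\<phi> holomorphic_on ball 0 1" and b: "bounded (\<phi> ` ball 0 1)" and h: "h \<in> hardy2_set"
  shows "(\<lambda>z. if z \<in> ball 0 1 then \<phi> z * h z else 0) \<in> hardy2_set" (is "?g \<in> _")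
    and "maclaurin_coeff (\<lambda>z. if z \<in> ball 0 1 then \<phi> z * h z else 0) n =
         maclaurin_coeff (\<lambda>z. \<phi> z * h z) n"
proof -
  have eq: "?g = (\<lambda>z. \<phi> z * h z)" using h by (auto simp: hardy2_set_def)
  thus "maclaurin_coeff ?g n = maclaurin_coeff (\<lambda>z. \<phi> z * h z) n" by simp
  from b obtain M where M: "\<And>z. z \<in> ball 0 1 \<Longrightarrow> cmod (\<phi> z) \<le> M"
    unfolding bounded_iff by blast
  have "summable (\<lambda>n. (cmod (maclaurin_coeff (\<lambda>z. \<phi> z * h z) n))\<^sup>2)"
    by (rule bounded_imp_summable)
      (use multiplier_partial_sum_le[OF \<phi> M h, of "Suc _"] in \<open>auto simp: lessThan_Suc_atMost\<close>)
  moreover have "(\<lambda>z. \<phi> z * h z) holomorphic_on ball 0 1"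
    using \<phi> h by (auto simp: hardy2_set_def intro!: holomorphic_intros)
  ultimately show "?g \<in> hardy2_set"
    using h by (simp only: eq) (auto simp: hardy2_set_def)
qed

lemma hardy2_fun_toeplitz:
  assumes "\<phi> holomorphic_on ball 0 1" "bounded (\<phi> ` ball 0 1)" "z \<in> ball 0 1"
  shows "hardy2_fun (toeplitz \<phi> h) z = \<phi> z * hardy2_fun h z"
  using multiplier_in_hardy2_set(1)[OF assms(1,2) hardy2_fun[of h]] assms(3)
  by (simp add: toeplitz_def Abs_hardy2_inverse)

lemma bounded_clinear_toeplitz:
  assumes \<phi>: "\<phi> holomorphic_on ball 0 1" and b: "bounded (\<phi> ` ball 0 1)"
  shows "bounded_clinear (toeplitz \<phi>)"
proof -
  note T = hardy2_fun_toeplitz[OF \<phi> b]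
  have add: "toeplitz \<phi> (f + g) = toeplitz \<phi> f + toeplitz \<phi> g" for f g
    by (rule hardy2_eqI) (simp only: T plus_hardy2.rep_eq distrib_left)
  have scaleC: "toeplitz \<phi> (c *\<^sub>C f) = c *\<^sub>C toeplitz \<phi> f" for c f
    by (rule hardy2_eqI)
      (simp only: T scaleC_hardy2_def hardy2_scaleC.rep_eq mult.left_commute)
  from b obtain M where M: "\<And>z. z \<in> ball 0 1 \<Longrightarrow> cmod (\<phi> z) \<le> M"
    unfolding bounded_iff by blast
  have M0: "M \<ge> 0" using order_trans[OF norm_ge_zero M[of 0]] by simp
  have bound: "norm (toeplitz \<phi> f) \<le> norm f * M" for f
  proof (rule hardy2_norm_leI)
    have "hardy2_coeff (toeplitz \<phi> f) n = maclaurin_coeff (\<lambda>z. \<phi> z * hardy2_fun f z) n" for n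
      using multiplier_in_hardy2_set[OF \<phi> b hardy2_fun[of f]]
      by (simp add: hardy2_coeff_def toeplitz_def Abs_hardy2_inverse)
    moreover have "(norm f)\<^sup>2 = (\<Sum>n. (cmod (maclaurin_coeff (hardy2_fun f) n))\<^sup>2)"
      unfolding hardy2_coeff_def[symmetric] by (simp add: norm_hardy2_def suminf_nonneg hardy2_summable)
    ultimately show "(\<Sum>n<N. (cmod (hardy2_coeff (toeplitz \<phi> f) n))\<^sup>2) \<le> (norm f * M)\<^sup>2" for N
      using multiplier_partial_sum_le[OF \<phi> M hardy2_fun[of f]]
      by (simp only: power_mult_distrib mult.commute)
  qed (use M0 in auto)
  have "bounded_linear (toeplitz \<phi>)"
  proof (rule bounded_linear_intro)
    show "toeplitz \<phi> (r *\<^sub>R f) = r *\<^sub>R toeplitz \<phi> f" for r f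
      using scaleC[of "of_real r" f] by (simp only: scaleC_of_real)
  qed (rule add bound)+
  thus ?thesis by (simp add: bounded_clinear_def scaleC)
qed


section \<open>Nondegenerate continua\<close>

definition nondegenerate_continuum :: "complex set \<Rightarrow> bool"
  where "nondegenerate_continuum K \<longleftrightarrow> compact K \<and> connected K \<and> (\<exists>x\<in>K. \<exists>y\<in>K. x \<noteq> y)"

end

theory Submission
  imports Defs
begin

text \<open>
  If \<open>\<psi>\<close> takes its values in the range of \<open>\<phi>\<close>, it lifts through the covering map: \<open>\<psi> = \<phi> \<circ> \<omega>\<close> with a
  holomorphic self-map \<open>\<omega>\<close> of the disc.  The composition operator with symbol \<open>\<omega>\<close>, multiplied by a nowhere
  vanishing weight, is then a nonzero intertwiner.  Its boundedness
  (\<open>weighted_composition_operator\<close>, \<open>subordinate_imp_intertwines\<close>) is Littlewood's subordination principle,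
  which has an algebraic proof when \<open>\<omega>\<close> has a zero in the disc and the weight is the reproducing
  kernel at that zero; a disc automorphism reduces the general case to this one.

  Conversely let \<open>X\<close> be a nonzero intertwiner and \<open>w\<close> a point of the disc.  The functional
  \<open>h \<mapsto> (X h)(w)\<close> annihilates \<open>(\<phi> - \<psi> w) H\<^sup>2\<close>.  The main point is that \<open>(\<phi> - a) H\<^sup>2\<close> is dense for each
  omitted value \<open>a\<close> (\<open>toeplitz_range_annihilator_zero\<close>), so that all \<open>X h\<close> vanish at \<open>w\<close> unless
  \<open>\<psi> w\<close> is a value of \<open>\<phi>\<close>.  This leaves as exceptions only the zeros of a nonzero function \<open>X h\<close>.  These are
  isolated.  A constant \<open>\<psi>\<close> takes its value at an unexceptional point; for other \<open>\<psi>\<close>, by the open mapping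
  theorem, an omitted value \<open>\<psi> w\<close> would be an isolated boundary point of the range of \<open>\<phi>\<close>, which is
  impossible for a union of nondegenerate continua.

  For a boundary value \<open>a\<close>, density means that \<open>\<phi> - a\<close> is outer.  It is enough to find bounded functions
  \<open>F\<close> for which \<open>F (\<phi> - a)\<close> is uniformly bounded and tends to \<open>1\<close>.  The construction is that of
  the Koebe function: \<open>a\<close> and a nearby point \<open>b\<close> lie in a small continuum omitted by \<open>\<phi>\<close>, therefore
  \<open>s = sqrt ((\<phi> - a) / (\<phi> - b))\<close>, with the branch that is close to \<open>1\<close> at points sent far from \<open>a\<close>, never comes near
  \<open>-1\<close>, and \<open>F (\<phi> - a) = 4 s\<^sup>2 / (1 + s)\<^sup>2\<close> has the required properties
  (\<open>koebe_multiplier\<close>).  That \<open>s\<close> avoids \<open>-1\<close> is a matter of winding numbers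
  (\<open>sqrt_ratio_no_sign_change\<close>).
\<close>

section \<open>Square roots on the complement of a continuum\<close>

text \<open>
  Boundary bumping.  If the component of \<open>x\<close> in \<open>K \<inter> cball x \<delta>\<close> stayed away from the sphere, a clopen
  neighbourhood of it given by the Sura-Bura theorem would be clopen in \<open>K\<close> itself, which is
  impossible because \<open>K\<close> is connected and contains a point outside the ball.
\<close>

lemma subcontinuum_reaching_sphere:
  fixes K :: "'a::euclidean_space set"
  assumes K: "compact K" "connected K" and x: "x \<in> K" and y: "y \<in> K"
    and \<delta>: "0 < \<delta>" "\<delta> < dist x y"
  obtains C b where "connected C" "C \<subseteq> K" "C \<subseteq> cball x \<delta>" "x \<in> C" "b \<in> C" "dist x b = \<delta>"
proof -
  define S where "S = K \<inter> cball x \<delta>"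
  define C where "C = connected_component_set S x"
  have S: "compact S" "x \<in> S"
    using K x \<delta> by (auto simp: S_def compact_Int)
  have C: "C \<in> components S" "x \<in> C" "C \<subseteq> S" "connected C"
    using S by (auto simp: C_def components_def connected_component_subset)
  have "\<exists>b\<in>C. dist x b = \<delta>"
  proof (rule ccontr)
    assume no: "\<not> ?thesis"
    have "C \<subseteq> ball x \<delta>"
      using C(3) no by (force simp: S_def less_le)
    moreover have "compact C"
      by (metis C(1) S(1) closed_components compact_eq_bounded_closed bounded_subset C(3))
    moreover have "locally compact S"
      using S(1) by (simp add: closed_imp_locally_compact compact_imp_closed)
    ultimately obtain V where V: "openin (top_of_set S) V" "compact V" "C \<subseteq> V" "V \<subseteq> ball x \<delta>"
      using Sura_Bura_clopen_subset[of S C "ball x \<delta>"] C(1) by auto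
    obtain W where W: "open W" "V = S \<inter> W"
      using V(1) by (auto simp: openin_open)
    have "V = K \<inter> (W \<inter> ball x \<delta>)"
      using W(2) V(4) ball_subset_cball[of x \<delta>] unfolding S_def by blast
    moreover have "open (W \<inter> ball x \<delta>)"
      using W(1) by blast
    ultimately have "openin (top_of_set K) V"
      unfolding openin_open by blast
    moreover have "closedin (top_of_set K) V"
      using V(2) W(2) by (simp add: closedin_compact_eq K S_def Int_assoc)
    ultimately have "V = {} \<or> V = K"
      using K(2) connected_clopen by blast
    moreover have "y \<notin> V" using V(4) \<delta> by auto
    ultimately show False using C(2) V(3) y by auto
  qed
  thus ?thesis
    using that[of C] C by (auto simp: S_def)
qed

text \<open>
  A loop that avoids a connected set winds equally often around any two of its points \<open>a\<close>, \<open>b\<close>.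
  Hence \<open>(g - a) / (g - b)\<close> has a continuous logarithm that closes up along \<open>g\<close>, and so does each of its
  continuous square roots.
\<close>

lemma sqrt_ratio_along_loop:
  fixes g P :: "real \<Rightarrow> complex"
  assumes g: "path g" "pathfinish g = pathstart g" and C: "connected C" "a \<in> C" "b \<in> C"
    and disj: "path_image g \<inter> C = {}" and P: "path P"
    and sq: "\<And>t. t \<in> {0..1} \<Longrightarrow> (P t)\<^sup>2 = (g t - a) / (g t - b)"
  shows "pathfinish P = pathstart P"
proof -
  have "winding_number g constant_on C"
    using winding_number_constant[OF g C(1)] disj by blast
  hence wn: "winding_number g a = winding_number g b"
    using C by (auto simp: constant_on_def)
  obtain p where p: "path p" "pathfinish p - pathstart p = 2 * of_real pi * \<i> * winding_number g a"
      "\<And>t. t \<in> {0..1} \<Longrightarrow> g t = a + exp (p t)"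
    using winding_number_as_continuous_log[OF g(1), of a] disj C(2) by blast
  obtain q where q: "path q" "pathfinish q - pathstart q = 2 * of_real pi * \<i> * winding_number g b"
      "\<And>t. t \<in> {0..1} \<Longrightarrow> g t = b + exp (q t)"
    using winding_number_as_continuous_log[OF g(1), of b] disj C(3) by blast
  define r where "r t = exp ((p t - q t) / 2)" for t
  have "p 1 - q 1 = p 0 - q 0"
    using p(2) q(2) wn by (simp add: pathfinish_def pathstart_def algebra_simps)
  hence r01: "r 1 = r 0" by (simp add: r_def)
  have r2: "(P t / r t)\<^sup>2 = 1" if "t \<in> {0..1}" for t
  proof -
    have half: "2 * (d / 2) = d" for d :: complex by simp
    have "(r t)\<^sup>2 = exp (p t - q t)"
      unfolding r_def exp_double[symmetric] half ..
    also have "\<dots> = exp (p t) / exp (q t)"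
      by (rule exp_diff)
    also have "\<dots> = (P t)\<^sup>2"
      using sq[OF that] p(3)[OF that] q(3)[OF that] by (metis add_diff_cancel_left')
    finally have "(P t / r t)\<^sup>2 = (r t)\<^sup>2 / (r t)\<^sup>2" by (simp only: power_divide)
    thus ?thesis by (simp add: r_def)
  qed
  have "continuous_on {0..1} (\<lambda>t. P t / r t)"
    using P p(1) q(1) unfolding r_def path_def by (intro continuous_intros) auto
  moreover have "(\<lambda>t. P t / r t) ` {0..1} \<subseteq> {1, -1}"
    using r2 unfolding power2_eq_1_iff by blast
  hence "finite ((\<lambda>t. P t / r t) ` {0..1})"
    by (rule finite_subset) auto
  ultimately have "(\<lambda>t. P t / r t) constant_on {0..1}"
    by (intro continuous_finite_range_constant) auto
  hence "P 1 / r 1 = P 0 / r 0"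
    by (auto simp: constant_on_def)
  thus ?thesis unfolding r01 by (simp add: r_def pathfinish_def pathstart_def)
qed

lemma ratio_near_one_Re_pos:
  fixes a b w :: complex
  assumes "2 * dist a b < dist w b"
  shows "Re ((w - a) / (w - b)) > 0"
proof -
  have ne: "w \<noteq> b" using assms by (auto simp: zero_le_dist not_less)
  have "(w - a) / (w - b) = 1 - (a - b) / (w - b)"
    using ne by (simp add: field_simps)
  moreover have "norm ((a - b) / (w - b)) < 1"
    using assms ne norm_ge_zero[of "a - b"] unfolding dist_norm norm_divide
    by (subst divide_less_eq_1_pos) (simp, linarith)
  ultimately show ?thesis
    using complex_Re_le_cmod[of "(a - b) / (w - b)"] by simp
qed

text \<open>
  Far away from \<open>a\<close> and \<open>b\<close> the quotient \<open>(w - a) / (w - b)\<close> lies in the right half plane.  If \<open>s\<close> agreed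
  with the principal root there at \<open>x\<close> but with its negative at \<open>y\<close>, then following \<open>f\<close> from \<open>f x\<close> to \<open>f y\<close>
  and returning through the far region would change the sign of the root along a loop that
  avoids \<open>C\<close>.
\<close>

lemma sqrt_ratio_no_sign_change:
  fixes f s :: "'a::topological_space \<Rightarrow> complex"
  assumes U: "path_connected U" and f: "continuous_on U f" and s: "continuous_on U s"
    and sq: "\<And>z. z \<in> U \<Longrightarrow> (s z)\<^sup>2 = (f z - a) / (f z - b)"
    and C: "connected C" "a \<in> C" "b \<in> C" "C \<subseteq> cball b (2 * dist a b)" "f ` U \<inter> C = {}"
    and x: "x \<in> U" "2 * dist a b < dist (f x) b" "Re (s x) > 0"
    and y: "y \<in> U" "2 * dist a b < dist (f y) b"
  shows "Re (s y) > 0"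
proof (rule ccontr)
  assume neg: "\<not> ?thesis"
  let ?m = "\<lambda>w. (w - a) / (w - b)"
  have pos: "Re (?m w) > 0" if "2 * dist a b < dist w b" for w
    using ratio_near_one_Re_pos that by blast
  have "csqrt (?m (f x)) = s x"
    using x sq[of x] by (intro csqrt_unique) auto
  have "Re (s y) \<noteq> 0"
  proof
    assume 0: "Re (s y) = 0"
    have "Re ((s y)\<^sup>2) \<le> 0" by (simp add: power2_eq_square 0)
    with pos[OF y(2)] sq[OF y(1)] show False by simp
  qed
  with neg have "csqrt (?m (f y)) = - s y"
    using y sq[of y] by (intro csqrt_unique) auto
  obtain h where h: "path h" "path_image h \<subseteq> U" "pathstart h = x" "pathfinish h = y"
    using U x(1) y(1) unfolding path_connected_def by blast
  have "path_connected (- cball b (2 * dist a b))"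
    by (rule path_connected_complement_bounded_convex) auto
  then obtain k where k: "path k" "path_image k \<subseteq> - cball b (2 * dist a b)"
      "pathstart k = f y" "pathfinish k = f x"
    using x(2) y(2) unfolding path_connected_def
    by (metis ComplI dist_commute linorder_not_le mem_cball)
  have k': "2 * dist a b < dist w b" if "w \<in> path_image k" for w
    using k(2) that by (auto simp: dist_commute)
  (* The root on the way back; its negative continues s at f y. *)
  define r where "r = csqrt \<circ> ?m \<circ> k"
  have cr: "continuous_on (path_image k) (csqrt \<circ> ?m)"
  proof (rule continuous_on_compose)
    show "continuous_on (path_image k) ?m"
      using k' by (intro continuous_intros) (force simp: zero_le_dist not_less)
    show "continuous_on (?m ` path_image k) csqrt"
      by (intro continuous_on_subset[OF continuous_on_csqrt]) (use pos k' in \<open>fastforce simp: complex_nonpos_Reals_iff\<close>)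
  qed
  have r: "path (- r)" "pathstart (- r) = s y" "pathfinish (- r) = - s x"
    using path_continuous_image[OF k(1) cr] k(3,4) \<open>csqrt (?m (f x)) = _\<close> \<open>csqrt (?m (f y)) = _\<close>
    by (auto simp: r_def path_def pathstart_def pathfinish_def fun_Compl_def comp_def 
             intro!: continuous_intros)
  define g where "g = (f \<circ> h) +++ k"
  define P where "P = (s \<circ> h) +++ (- r)"
  have fh: "path (f \<circ> h)" "path (s \<circ> h)"
    using h f s by (auto intro!: path_continuous_image intro: continuous_on_subset)
  have "path g" "pathfinish g = pathstart g"
    using fh h k by (auto simp: g_def pathfinish_compose pathstart_compose)
  moreover have "path P"
    using fh h r by (simp add: P_def pathfinish_compose)
  moreover have "path_image g \<inter> C = {}"
    using C(4,5) k h(2) path_image_join_subset[of "f \<circ> h" k]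
    unfolding g_def path_image_compose by blast
  moreover have "(P t)\<^sup>2 = ?m (g t)" if "t \<in> {0..1}" for t
  proof (cases "t \<le> 1/2")
    case True
    hence "h (2 * t) \<in> U" using h(2) that by (auto simp: path_image_def)
    thus ?thesis using True sq by (simp add: P_def g_def joinpaths_def)
  next
    case False
    thus ?thesis by (simp add: P_def g_def joinpaths_def r_def)
  qed
  ultimately have "pathfinish P = pathstart P"
    using sqrt_ratio_along_loop[of g C a b P] C by blast
  hence "- s x = s x"
    using r h by (simp add: P_def pathstart_compose)
  thus False using x(3) by simp
qed

text \<open>
  The function \<open>4 s\<^sup>2 / (1 + s)\<^sup>2\<close> with \<open>s\<^sup>2 = (w - a) / (w - b)\<close> is close to \<open>1\<close> away from \<open>a\<close> and \<open>b\<close>, where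
  \<open>s\<close> is close to \<open>1\<close>, and vanishes at \<open>a\<close> to first order in \<open>w\<close>, so that dividing it by \<open>w - a\<close> leaves a
  bounded function.  It is bounded by an absolute constant as soon as \<open>s\<close> stays away from \<open>-1\<close>
  uniformly, and this holds if \<open>a\<close> and \<open>b\<close> are joined by a connected set that \<open>\<phi>\<close> omits and whose diameter
  is comparable to \<open>dist a b\<close>: a value of \<open>s\<close> near \<open>-1\<close> would occur in the far region, where \<open>s\<close> is
  the principal root.
\<close>

lemma koebe_multiplier:
  fixes \<phi> :: "complex \<Rightarrow> complex"
  assumes \<phi>: "\<phi> holomorphic_on ball 0 1"
    and K: "compact K" "connected K" "\<phi> ` ball 0 1 \<inter> K = {}" "a \<in> K" "y \<in> K"
    and \<delta>: "0 < \<delta>" "\<delta> < dist a y" "3 * \<delta> < dist a (\<phi> 0)"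
  obtains F where "F holomorphic_on ball 0 1" "bounded (F ` ball 0 1)"
    "\<And>z. z \<in> ball 0 1 \<Longrightarrow> cmod (F z * (\<phi> z - a)) \<le> 144"
    "\<And>z. z \<in> ball 0 1 \<Longrightarrow> cmod (F z * (\<phi> z - a) - 1) * (dist (\<phi> z) a - \<delta>) \<le> 325 * \<delta>"
proof -
  let ?U = "ball 0 1 :: complex set"
  obtain C b where C: "connected C" "C \<subseteq> K" "C \<subseteq> cball a \<delta>" "a \<in> C" "b \<in> C" and ab: "dist a b = \<delta>"
    using subcontinuum_reaching_sphere[OF K(1,2,4,5) \<delta>(1,2)] by metis
  have ne: "\<phi> z \<noteq> a" "\<phi> z \<noteq> b" if "z \<in> ?U" for z
    using K(3,4) C(2,5) that by blast+
  have "C \<subseteq> cball b (2 * dist a b)"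
  proof
    fix w assume "w \<in> C"
    hence "dist a w \<le> \<delta>" using C(3) by auto
    thus "w \<in> cball b (2 * dist a b)"
      using ab dist_triangle2[of b w a] by (simp add: dist_commute)
  qed
  note C' = C(1,4,5) this
  have disj: "\<phi> ` ?U \<inter> C = {}" using K(3) C(2) by blast
  have far0: "2 * dist a b < dist (\<phi> 0) b"
    using \<delta>(3) ab dist_triangle2[of a "\<phi> 0" b] by (simp add: dist_commute)
  have "(\<lambda>z. (\<phi> z - a) / (\<phi> z - b)) holomorphic_on ?U"
    using ne by (intro holomorphic_intros \<phi>) auto
  then obtain s0 where s0: "s0 holomorphic_on ?U"
      "\<And>z. z \<in> ?U \<Longrightarrow> (\<phi> z - a) / (\<phi> z - b) = (s0 z)\<^sup>2"
    by (rule contractible_imp_holomorphic_sqrt) (use ne in \<open>auto intro: convex_imp_contractible\<close>)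
  have "Re (s0 0) \<noteq> 0"
  proof
    assume 0: "Re (s0 0) = 0"
    have "Re ((s0 0)\<^sup>2) \<le> 0" by (simp add: power2_eq_square 0)
    with ratio_near_one_Re_pos[OF far0] s0(2)[of 0] show False by simp
  qed
  then obtain s where s: "s holomorphic_on ?U"
      "\<And>z. z \<in> ?U \<Longrightarrow> (s z)\<^sup>2 = (\<phi> z - a) / (\<phi> z - b)" "Re (s 0) > 0"
  proof (cases "Re (s0 0) > 0")
    case True
    thus ?thesis using that[of s0] s0 by simp
  next
    case False
    thus ?thesis using that[of "\<lambda>z. - s0 z"] s0 \<open>Re (s0 0) \<noteq> 0\<close> by (auto intro!: holomorphic_intros)
  qed
  have s2: "(s z)\<^sup>2 - 1 = (b - a) / (\<phi> z - b)" if "z \<in> ?U" for z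
    using s(2)[OF that] ne[OF that] by (simp add: field_simps)
  have s2n: "cmod ((s z)\<^sup>2 - 1) = \<delta> / dist (\<phi> z) b" if "z \<in> ?U" for z
    using ab by (simp add: s2[OF that] norm_divide dist_norm norm_minus_commute)
  (* If |1 + s| < 1/5, then |s^2 - 1| < (1/5)(11/5) < 1/2, and so z is mapped to the far region,
     where Re s > 0. *)
  have away: "cmod (1 + s z) \<ge> 1/5" if z: "z \<in> ?U" for z
  proof (rule ccontr)
    assume small: "\<not> ?thesis"
    have "cmod (s z - 1) \<le> cmod (1 + s z) + 2"
      using norm_triangle_ineq4[of "1 + s z" 2] by (simp add: algebra_simps)
    hence "cmod (1 + s z) * cmod (s z - 1) \<le> (1/5) * (11/5)"
      using small by (intro mult_mono) auto
    moreover have "(s z)\<^sup>2 - 1 = (1 + s z) * (s z - 1)"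
      by (simp add: power2_eq_square algebra_simps)
    ultimately have "\<delta> / dist (\<phi> z) b < 1/2"
      unfolding s2n[OF z, symmetric] by (simp add: norm_mult)
    hence "2 * dist a b < dist (\<phi> z) b"
      using ne[OF z] ab by (simp add: field_simps)
    hence "Re (s z) > 0"
      by (intro sqrt_ratio_no_sign_change[OF _ _ _ s(2) C' disj _ far0 s(3) z])
         (auto intro!: holomorphic_on_imp_continuous_on s \<phi> convex_imp_path_connected)
    thus False using small abs_Re_le_cmod[of "1 + s z"] by simp
  qed
  hence nz: "1 + s z \<noteq> 0" if "z \<in> ?U" for z using that by force
  have inv: "cmod (1 / (1 + s z)) \<le> 5" if "z \<in> ?U" for z
    using away[OF that] nz[OF that] by (simp add: norm_divide field_simps)
  define F where "F z = 4 / ((\<phi> z - b) * (1 + s z)\<^sup>2)" for z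
  have G: "F z * (\<phi> z - a) = (2 - 2 * (1 / (1 + s z)))\<^sup>2" if z: "z \<in> ?U" for z
  proof -
    have "F z * (\<phi> z - a) = 4 * (s z)\<^sup>2 / (1 + s z)\<^sup>2"
      by (simp add: F_def s(2)[OF z])
    also have "\<dots> = (2 * s z / (1 + s z))\<^sup>2" by (simp add: power_divide power_mult_distrib)
    also have "2 * s z / (1 + s z) = 2 - 2 * (1 / (1 + s z))"
      using nz[OF z] by (simp add: field_simps)
    finally show ?thesis .
  qed
  have bound: "cmod (F z * (\<phi> z - a)) \<le> 144" if z: "z \<in> ?U" for z
  proof -
    have "cmod (2 - 2 * (1 / (1 + s z))) \<le> 12"
      using norm_triangle_ineq4[of 2 "2 * (1 / (1 + s z))"] inv[OF z]
      by (simp add: norm_mult norm_divide)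
    from power_mono[OF this, of 2] show ?thesis by (simp add: G[OF z] norm_power)
  qed
  (* Near b the bound on F (phi - a) is used, elsewhere the definition of F. *)
  have F_bound: "cmod (F z) \<le> 288 / \<delta>" if z: "z \<in> ?U" for z
  proof (cases "dist (\<phi> z) b \<ge> \<delta> / 2")
    case True
    have "cmod (F z) = 4 * (cmod (1 / (1 + s z)))\<^sup>2 / dist (\<phi> z) b"
      by (simp add: F_def norm_divide norm_mult norm_power dist_norm power_divide)
    also have "\<dots> \<le> 4 * 5\<^sup>2 / (\<delta> / 2)"
      using True \<delta> by (intro frac_le mult_left_mono power_mono inv z) auto
    also have "\<dots> \<le> 288 / \<delta>" using \<delta> by (simp add: field_simps)
    finally show ?thesis .
  next
    case False
    hence "\<delta> / 2 \<le> cmod (\<phi> z - a)"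
      using dist_triangle2[of a b "\<phi> z"] ab by (simp add: dist_norm norm_minus_commute)
    hence "cmod (F z) * (\<delta> / 2) \<le> cmod (F z) * cmod (\<phi> z - a)"
      by (intro mult_left_mono) auto
    also have "\<dots> \<le> 144" using bound[OF z] by (simp add: norm_mult)
    finally show ?thesis using \<delta> by (simp add: field_simps)
  qed
  show ?thesis
  proof (rule that)
    show "F holomorphic_on ?U"
      unfolding F_def using ne nz by (intro holomorphic_intros s \<phi>) auto
    show "bounded (F ` ?U)"
      unfolding bounded_iff using F_bound by blast
    show "cmod (F z * (\<phi> z - a)) \<le> 144" if "z \<in> ?U" for z
      using bound that .
    fix z assume z: "z \<in> ?U"
    let ?i = "1 / (1 + s z)"
    have "F z * (\<phi> z - a) - 1 = ((s z)\<^sup>2 - 1) * (3 - 2 * ?i) * ?i\<^sup>2"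
    proof -
      have "(2 - 2 * i)\<^sup>2 - 1 = (x\<^sup>2 - 1) * (3 - 2 * i) * i\<^sup>2" if "(1 + x) * i = 1" for x i :: complex
        using that by algebra
      from this[of "s z" ?i] show ?thesis using nz[OF z] by (simp add: G[OF z])
    qed
    moreover have "cmod (3 - 2 * ?i) \<le> 13"
      using norm_triangle_ineq4[of 3 "2 * ?i"] inv[OF z] by (simp add: norm_mult norm_divide)
    moreover have "(cmod ?i)\<^sup>2 \<le> 5\<^sup>2"
      by (intro power_mono inv z) auto
    moreover have "\<delta> / dist (\<phi> z) b * cmod (3 - 2 * ?i) * (cmod ?i)\<^sup>2 \<le> \<delta> / dist (\<phi> z) b * 13 * 5\<^sup>2"
      using calculation(2,3) \<delta>(1) by (intro mult_mono mult_left_mono) auto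
    ultimately have "cmod (F z * (\<phi> z - a) - 1) \<le> \<delta> / dist (\<phi> z) b * 13 * 5\<^sup>2"
      by (simp only: norm_mult norm_power s2n[OF z])
    moreover have d: "dist (\<phi> z) b > 0" "dist (\<phi> z) a - \<delta> \<le> dist (\<phi> z) b"
      using ne[OF z] dist_triangle2[of "\<phi> z" a b] ab by auto
    ultimately have "cmod (F z * (\<phi> z - a) - 1) * dist (\<phi> z) b \<le> 325 * \<delta>"
      by (simp add: field_simps)
    thus "cmod (F z * (\<phi> z - a) - 1) * (dist (\<phi> z) a - \<delta>) \<le> 325 * \<delta>"
      using mult_left_mono[OF d(2), of "cmod (F z * (\<phi> z - a) - 1)"] by simp
  qed
qed

section \<open>Functionals on the Hardy space\<close>

lemma toeplitz_norm_le:
  assumes \<phi>: "\<phi> holomorphic_on ball 0 1" and M: "\<And>z. z \<in> ball 0 1 \<Longrightarrow> cmod (\<phi> z) \<le> M"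
  shows "norm (toeplitz \<phi> h) \<le> M * norm h"
proof (rule hardy2_norm_leI)
  have b: "bounded (\<phi> ` ball 0 1)" using M unfolding bounded_iff by blast
  have "hardy2_coeff (toeplitz \<phi> h) n = maclaurin_coeff (\<lambda>z. \<phi> z * hardy2_fun h z) n" for n
    using multiplier_in_hardy2_set[OF \<phi> b hardy2_fun[of h]]
    by (simp add: hardy2_coeff_def toeplitz_def Abs_hardy2_inverse)
  moreover have "(norm h)\<^sup>2 = (\<Sum>n. (cmod (maclaurin_coeff (hardy2_fun h) n))\<^sup>2)"
    unfolding hardy2_coeff_def[symmetric] by (simp add: norm_hardy2_def suminf_nonneg hardy2_summable)
  ultimately show "(\<Sum>n<N. (cmod (hardy2_coeff (toeplitz \<phi> h) n))\<^sup>2) \<le> (M * norm h)\<^sup>2" for N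
    using multiplier_partial_sum_le[OF \<phi> M hardy2_fun[of h]]
    by (simp only: power_mult_distrib)
  show "0 \<le> M * norm h"
    using order_trans[OF norm_ge_zero M[of 0]] by simp
qed

lemma hardy2_fun_add: "hardy2_fun (f + g) z = hardy2_fun f z + hardy2_fun g z"
  by (simp add: plus_hardy2.rep_eq)

lemma hardy2_fun_scaleC: "hardy2_fun (c *\<^sub>C f) z = c * hardy2_fun f z"
  by (simp add: scaleC_hardy2_def hardy2_scaleC.rep_eq)

lemma hardy2_fun_scaleR: "hardy2_fun (r *\<^sub>R f) z = of_real r * hardy2_fun f z"
  by (simp add: scaleR_hardy2.rep_eq)

lemma hardy2_fun_diff: "hardy2_fun (f - g) z = hardy2_fun f z - hardy2_fun g z"
  using hardy2_fun_add[of "f - g" g z] by simp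

lemma hardy2_coeff_scaleC_op: "hardy2_coeff (c *\<^sub>C f) n = c * hardy2_coeff f n"
  by (simp add: scaleC_hardy2_def hardy2_coeff_scaleC)

lemma hardy2_norm_sums: "(\<lambda>n. (cmod (hardy2_coeff f n))\<^sup>2) sums (norm f)\<^sup>2"
  using summable_sums[OF hardy2_summable[of f]]
  by (simp add: norm_hardy2_def suminf_nonneg hardy2_summable)

lemma hardy2_inner_sums: "(\<lambda>n. inner (hardy2_coeff f n) (hardy2_coeff g n)) sums inner f g"
  using summable_sums[OF summable_inner_hardy2] by (simp add: inner_hardy2_alt)

text \<open>
  The reproducing (Szego) kernel \<open>z \<mapsto> 1 / (1 - cnj w z)\<close>.
\<close>

definition hardy2_kernel :: "complex \<Rightarrow> hardy2"
  where "hardy2_kernel w = (SOME f. hardy2_coeff f = (\<lambda>n. cnj w ^ n))"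

lemma hardy2_coeff_kernel:
  assumes "w \<in> ball 0 1"
  shows "hardy2_coeff (hardy2_kernel w) n = cnj w ^ n"
proof -
  have "summable (\<lambda>n. ((cmod w)\<^sup>2) ^ n)"
    using assms by (intro summable_geometric) (simp add: power_less_one_iff)
  hence "summable (\<lambda>n. (cmod (cnj w ^ n))\<^sup>2)"
    by (simp add: norm_power mult.commute flip: power_mult)
  from hardy2_coeff_surj[OF this] have "\<exists>f. hardy2_coeff f = (\<lambda>n. cnj w ^ n)"
    by metis
  from someI_ex[OF this] show ?thesis by (simp add: hardy2_kernel_def)
qed

lemma inner_scaleC_kernel:
  assumes "w \<in> ball 0 1"
  shows "inner f (c *\<^sub>C hardy2_kernel w) = Re (cnj c * hardy2_fun f w)"
proof -
  have "(\<lambda>n. Re (cnj c * (hardy2_coeff f n * w ^ n))) sums Re (cnj c * hardy2_fun f w)"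
    by (intro sums_Re sums_mult hardy2_sums assms)
  moreover have "Re (cnj c * (hardy2_coeff f n * w ^ n)) =
      inner (hardy2_coeff f n) (hardy2_coeff (c *\<^sub>C hardy2_kernel w) n)" for n
    by (simp add: hardy2_coeff_scaleC_op hardy2_coeff_kernel[OF assms] cmod_def inner_complex_def 
        flip: complex_cnj_power) (simp add: algebra_simps)
  ultimately show ?thesis
    using hardy2_inner_sums[of f "c *\<^sub>C hardy2_kernel w"] sums_unique2 by fastforce
qed

lemma scaleC_one: "1 *\<^sub>C (x::'a::complex_hilbert_space) = x"
  using scaleC_of_real[of 1 x] by simp

lemma inner_kernel: "w \<in> ball 0 1 \<Longrightarrow> inner f (hardy2_kernel w) = Re (hardy2_fun f w)"
  using inner_scaleC_kernel[of w f 1] by (simp add: scaleC_one)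

lemma hardy2_fun_at_0: "hardy2_fun f 0 = hardy2_coeff f 0"
  by (simp add: hardy2_coeff_def maclaurin_coeff_def)

lemma hardy2_fun_tendsto:
  assumes X: "(X \<longlongrightarrow> f) F" and w: "w \<in> ball 0 1"
  shows "((\<lambda>n. hardy2_fun (X n) w) \<longlongrightarrow> hardy2_fun f w) F"
proof -
  have "((\<lambda>n. inner (X n) (c *\<^sub>C hardy2_kernel w)) \<longlongrightarrow> inner f (c *\<^sub>C hardy2_kernel w)) F" for c
    by (intro tendsto_intros X)
  from this[of 1] this[of \<i>] show ?thesis
    by (simp add: inner_scaleC_kernel[OF w] tendsto_complex_iff)
qed

definition hardy2_monom :: "complex \<Rightarrow> nat \<Rightarrow> hardy2"
  where "hardy2_monom c n = (SOME f. hardy2_coeff f = (\<lambda>k. if k = n then c else 0))"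

lemma hardy2_coeff_monom: "hardy2_coeff (hardy2_monom c n) k = (if k = n then c else 0)"
proof -
  have "summable (\<lambda>k. (cmod (if k = n then c else 0))\<^sup>2)"
    by (rule summable_finite[of "{n}"]) auto
  from hardy2_coeff_surj[OF this] have "\<exists>f. hardy2_coeff f = (\<lambda>k. if k = n then c else 0)"
    by metis
  from someI_ex[OF this] show ?thesis by (simp add: hardy2_monom_def)
qed

lemma hardy2_coeff_sum: "hardy2_coeff (\<Sum>i\<in>A. f i) n = (\<Sum>i\<in>A. hardy2_coeff (f i) n)"
  by (induction A rule: infinite_finite_induct) (auto simp: hardy2_coeff_0 hardy2_coeff_add)

lemma hardy2_taylor_tendsto: "(\<lambda>N. \<Sum>n<N. hardy2_monom (hardy2_coeff f n) n) \<longlonglongrightarrow> f"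
proof -
  let ?p = "\<lambda>N. \<Sum>n<N. hardy2_monom (hardy2_coeff f n) n"
  let ?S = "\<lambda>N. \<Sum>n<N. (cmod (hardy2_coeff f n))\<^sup>2"
  have c: "hardy2_coeff (f - ?p N) n = (if n < N then 0 else hardy2_coeff f n)" for N n
    by (simp add: hardy2_coeff_diff hardy2_coeff_sum hardy2_coeff_monom)
  have "(norm (f - ?p N))\<^sup>2 = (norm f)\<^sup>2 - ?S N" for N
  proof -
    have "(\<lambda>n. (cmod (hardy2_coeff f n))\<^sup>2 - (if n \<in> {..<N} then (cmod (hardy2_coeff f n))\<^sup>2 else 0)) sums
        ((norm f)\<^sup>2 - ?S N)"
      by (intro sums_diff hardy2_norm_sums sums_If_finite_set) auto
    also have "(\<lambda>n. (cmod (hardy2_coeff f n))\<^sup>2 - (if n \<in> {..<N} then (cmod (hardy2_coeff f n))\<^sup>2 else 0))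
        = (\<lambda>n. (cmod (hardy2_coeff (f - ?p N) n))\<^sup>2)"
      by (auto simp: c)
    finally show ?thesis
      by (rule sums_unique2[OF hardy2_norm_sums])
  qed
  moreover have "(\<lambda>N. (norm f)\<^sup>2 - ?S N) \<longlonglongrightarrow> (norm f)\<^sup>2 - (norm f)\<^sup>2"
    using hardy2_norm_sums[of f] unfolding sums_def by (intro tendsto_intros)
  ultimately have "(\<lambda>N. sqrt ((norm (f - ?p N))\<^sup>2)) \<longlonglongrightarrow> sqrt 0"
    by (intro tendsto_real_sqrt) simp
  hence "(\<lambda>N. norm (?p N - f)) \<longlonglongrightarrow> 0"
    by (simp add: norm_minus_commute)
  thus ?thesis
    by (simp add: tendsto_norm_zero_iff flip: LIM_zero_iff[of _ f])
qed

text \<open>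
  The real form of the Riesz representation theorem.  The coefficients of \<open>g\<close> are read off from the
  values of \<open>R\<close> on monomials; testing \<open>R\<close> on the Taylor polynomials of \<open>g\<close> shows that they are square
  summable.
\<close>

lemma hardy2_riesz:
  fixes R :: "hardy2 \<Rightarrow> real"
  assumes "bounded_linear R"
  shows "\<exists>g. \<forall>h. R h = inner h g"
proof -
  interpret R: bounded_linear R by fact
  obtain L where L: "\<And>h. norm (R h) \<le> norm h * L" "L \<ge> 0"
    using R.nonneg_bounded by blast
  define a where "a n = Complex (R (hardy2_monom 1 n)) (R (hardy2_monom \<i> n))" for n
  have Rm: "R (hardy2_monom c n) = inner c (a n)" for c n
  proof -
    have "hardy2_monom c n = Re c *\<^sub>R hardy2_monom 1 n + Im c *\<^sub>R hardy2_monom \<i> n"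
      by (rule hardy2_coeff_eqI)
         (auto simp: hardy2_coeff_add hardy2_coeff_scaleR hardy2_coeff_monom complex_eq_iff)
    thus ?thesis by (simp add: R.add R.scaleR a_def inner_complex_def)
  qed
  have "summable (\<lambda>n. (cmod (a n))\<^sup>2)"
  proof (rule bounded_imp_summable)
    fix N
    let ?s = "\<Sum>n\<le>N. (cmod (a n))\<^sup>2"
    define f where "f = (\<Sum>n\<le>N. hardy2_monom (a n) n)"
    have cf: "hardy2_coeff f n = (if n \<in> {..N} then a n else 0)" for n
      by (simp add: f_def hardy2_coeff_sum hardy2_coeff_monom)
    have "(\<lambda>n. if n \<in> {..N} then (cmod (a n))\<^sup>2 else 0) sums ?s"
      by (intro sums_If_finite_set) auto
    moreover have "(\<lambda>n. if n \<in> {..N} then (cmod (a n))\<^sup>2 else 0) = (\<lambda>n. (cmod (hardy2_coeff f n))\<^sup>2)"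
      by (auto simp: cf)
    ultimately have nf: "(norm f)\<^sup>2 = ?s"
      using hardy2_norm_sums[of f] sums_unique2 by metis
    have "?s = R f"
      by (simp add: f_def R.sum Rm dot_square_norm)
    hence "(norm f)\<^sup>2 \<le> norm f * L" using L(1)[of f] nf by simp
    hence "norm f \<le> L" using L(2) by (cases "norm f = 0") (auto simp: power2_eq_square)
    from power_mono[OF this, of 2] show "?s \<le> L\<^sup>2" using nf by simp
  qed simp
  from hardy2_coeff_surj[OF this] obtain g where g: "hardy2_coeff g = a" .
  have "R h = inner h g" for h
  proof (rule LIMSEQ_unique)
    show "(\<lambda>N. R (\<Sum>n<N. hardy2_monom (hardy2_coeff h n) n)) \<longlonglongrightarrow> R h"
      by (intro R.tendsto hardy2_taylor_tendsto)
    have "(\<lambda>N. \<Sum>n<N. inner (hardy2_coeff h n) (hardy2_coeff g n)) \<longlonglongrightarrow> inner h g"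
      using hardy2_inner_sums by (simp add: sums_def)
    thus "(\<lambda>N. R (\<Sum>n<N. hardy2_monom (hardy2_coeff h n) n)) \<longlonglongrightarrow> inner h g"
      by (simp add: R.sum Rm g)
  qed
  thus ?thesis by blast
qed

lemma inner_monom: "inner f (hardy2_monom c n) = inner (hardy2_coeff f n) c"
proof -
  have "(\<lambda>k. if k = n then inner (hardy2_coeff f k) c else 0) sums inner (hardy2_coeff f n) c"
    by (rule sums_single)
  moreover have "(if k = n then inner (hardy2_coeff f k) c else 0) =
      inner (hardy2_coeff f k) (hardy2_coeff (hardy2_monom c n) k)" for k
    by (simp add: hardy2_coeff_monom)
  ultimately have "(\<lambda>k. inner (hardy2_coeff f k) (hardy2_coeff (hardy2_monom c n) k)) sums
      inner (hardy2_coeff f n) c" by simp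
  from sums_unique2[OF hardy2_inner_sums this] show ?thesis .
qed

text \<open>
  A norm bounded sequence with convergent coefficients converges weakly, since the element representing
  \<open>R\<close> can be approximated by a polynomial, against which only finitely many coefficients matter.
\<close>

lemma hardy2_weak_tendsto:
  fixes R :: "hardy2 \<Rightarrow> real"
  assumes R: "bounded_linear R" and B: "\<And>j. norm (f j) \<le> B"
    and c: "\<And>n. (\<lambda>j. hardy2_coeff (f j) n) \<longlonglongrightarrow> hardy2_coeff h n"
  shows "(\<lambda>j. R (f j)) \<longlonglongrightarrow> R h"
proof -
  obtain g where g: "\<And>h. R h = inner h g"
    using hardy2_riesz[OF R] by blast
  define p where "p N = (\<Sum>n<N. hardy2_monom (hardy2_coeff g n) n)" for N
  have B0: "B \<ge> 0" using order_trans[OF norm_ge_zero B[of 0]] .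
  show ?thesis
  proof (rule LIMSEQ_I)
    fix e :: real assume e: "e > 0"
    define D where "D = B + norm h + 1"
    have D: "D > 0" using B0 by (simp add: D_def add_nonneg_pos)
    have "p \<longlonglongrightarrow> g" unfolding p_def by (rule hardy2_taylor_tendsto)
    then obtain N where N: "norm (p N - g) < e / (2 * D)"
      using LIMSEQ_D[of p g "e / (2 * D)"] e D by auto
    have "(\<lambda>j. inner (f j) (p N)) \<longlonglongrightarrow> inner h (p N)"
      unfolding p_def inner_sum_right inner_monom by (intro tendsto_intros c)
    then obtain J where J: "\<And>j. j \<ge> J \<Longrightarrow> norm (inner (f j) (p N) - inner h (p N)) < e / 2"
      using LIMSEQ_D[of _ _ "e / 2"] e by (metis half_gt_zero)
    have "norm (R (f j) - R h) < e" if "j \<ge> J" for j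
    proof -
      have "R (f j) - R h = (inner (f j) (p N) - inner h (p N)) - inner (f j - h) (p N - g)"
        by (simp add: g inner_diff_left inner_diff_right)
      hence "norm (R (f j) - R h) \<le> norm (inner (f j) (p N) - inner h (p N)) + norm (inner (f j - h) (p N - g))"
        by (metis norm_triangle_ineq4)
      also have "norm (inner (f j - h) (p N - g)) \<le> norm (f j - h) * norm (p N - g)"
        using Cauchy_Schwarz_ineq2[of "f j - h" "p N - g"] by simp
      also have "\<dots> \<le> D * (e / (2 * D))"
        using N B[of j] norm_triangle_ineq4[of "f j" h] D by (intro mult_mono) (auto simp: D_def)
      also have "\<dots> = e / 2" using D by simp
      finally show ?thesis using J[OF that] by simp
    qed
    thus "\<exists>J. \<forall>j\<ge>J. norm (R (f j) - R h) < e" by blast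
  qed
qed

text \<open>
  A criterion for the range of an analytic Toeplitz operator to be dense, phrased for functionals
  that annihilate it: the functions \<open>F j * f * h\<close> lie in the range of multiplication by \<open>f\<close>, are bounded in norm
  and converge coefficientwise, hence weakly, to \<open>h\<close>.
\<close>

lemma functional_vanishes_of_multipliers:
  fixes R :: "hardy2 \<Rightarrow> real"
  assumes R: "bounded_linear R" and f: "f holomorphic_on ball 0 1" "bounded (f ` ball 0 1)"
    and kill: "\<And>h. R (toeplitz f h) = 0"
    and F: "\<And>j. F j holomorphic_on ball 0 1" "\<And>j. bounded (F j ` ball 0 1)"
    and M: "\<And>j z. z \<in> ball 0 1 \<Longrightarrow> cmod (F j z * f z) \<le> M"
    and r: "0 < r" "r < 1"
    and lim: "uniform_limit (ball 0 r) (\<lambda>j z. F j z * f z) (\<lambda>_. 1) sequentially"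
  shows "R h = 0"
proof -
  let ?u = "\<lambda>j. toeplitz f (toeplitz (F j) h)"
  have u: "hardy2_fun (?u j) z = F j z * f z * hardy2_fun h z" if "z \<in> ball 0 1" for j z
    using that by (simp add: hardy2_fun_toeplitz f F)
  have sub: "ball 0 r \<subseteq> (ball 0 1 :: complex set)" using r by auto
  have "norm (?u j) \<le> M * norm h" for j
  proof -
    have b: "bounded ((\<lambda>z. F j z * f z) ` ball 0 1)"
      unfolding bounded_iff using M[of _ j] by blast
    have "?u j = toeplitz (\<lambda>z. F j z * f z) h"
      by (rule hardy2_eqI) (use u in \<open>simp add: hardy2_fun_toeplitz[OF _ b] holomorphic_on_mult F f\<close>)
    thus ?thesis using M by (auto intro!: toeplitz_norm_le holomorphic_on_mult F f)
  qed
  moreover have "(\<lambda>j. hardy2_coeff (?u j) n) \<longlonglongrightarrow> hardy2_coeff h n" for n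
  proof -
    have "compact (hardy2_fun h ` cball 0 r)"
      by (intro compact_continuous_image continuous_on_subset[OF
            holomorphic_on_imp_continuous_on[OF hardy2_fun_holomorphic]]) (use r in auto)
    hence bh: "bounded (hardy2_fun h ` ball 0 r)"
      by (meson ball_subset_cball bounded_subset compact_imp_bounded image_mono)
    have b1: "bounded ((\<lambda>_. 1 :: complex) ` ball (0::complex) r)"
      unfolding bounded_iff by (rule exI[of _ 1]) auto
    have "uniform_limit (ball 0 r) (\<lambda>j z. F j z * f z * hardy2_fun h z)
        (\<lambda>z. 1 * hardy2_fun h z) sequentially"
      by (intro uniform_lim_mult lim uniform_limit_const bh b1)
    also have "?this \<longleftrightarrow> uniform_limit (ball 0 r) (\<lambda>j. hardy2_fun (?u j)) (hardy2_fun h) sequentially"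
      by (intro uniform_limit_cong) (use u r in \<open>auto intro!: always_eventually\<close>)
    finally have "(\<lambda>j. (deriv ^^ n) (hardy2_fun (?u j)) 0) \<longlonglongrightarrow> (deriv ^^ n) (hardy2_fun h) 0"
      by (rule higher_deriv_complex_uniform_limit)
         (use r sub in \<open>auto intro!: always_eventually holomorphic_on_subset[OF hardy2_fun_holomorphic]\<close>)
    thus ?thesis
      unfolding hardy2_coeff_def maclaurin_coeff_def by (intro tendsto_intros) auto
  qed
  ultimately have "(\<lambda>j. R (?u j)) \<longlonglongrightarrow> R h"
    by (rule hardy2_weak_tendsto[OF R])
  thus ?thesis by (simp add: kill LIMSEQ_const_iff)
qed

section \<open>Density of the range of an analytic Toeplitz operator\<close>

text \<open>
  Density of \<open>(\<phi> - a) H\<^sup>2\<close> for an omitted value \<open>a\<close>.  For \<open>a\<close> off the closure of the range of \<open>\<phi>\<close> the multiplier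
  \<open>1 / (\<phi> - a)\<close> is bounded.  For a boundary value it is replaced by the multipliers of
  \<open>koebe_multiplier\<close>, which approximate it as \<open>\<delta>\<close> shrinks.
\<close>

lemma toeplitz_range_annihilator_zero:
  fixes R :: "hardy2 \<Rightarrow> real"
  assumes \<phi>: "\<phi> holomorphic_on ball 0 1" "bounded (\<phi> ` ball 0 1)"
    and a: "a \<notin> \<phi> ` ball 0 1"
    and K: "a \<in> frontier (\<phi> ` ball 0 1) \<Longrightarrow> \<exists>K. nondegenerate_continuum K \<and> a \<in> K \<and> \<phi> ` ball 0 1 \<inter> K = {}"
    and R: "bounded_linear R" and kill: "\<And>h. R (toeplitz (\<lambda>z. \<phi> z - a) h) = 0"
  shows "R h = 0"
proof -
  let ?U = "ball 0 1 :: complex set"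
  let ?f = "\<lambda>z. \<phi> z - a"
  have f: "?f holomorphic_on ?U" "bounded (?f ` ?U)"
  proof -
    show "?f holomorphic_on ?U" by (intro holomorphic_intros \<phi>)
    have "?f ` ?U = (\<lambda>w. - a + w) ` \<phi> ` ?U" by (auto simp: image_image)
    thus "bounded (?f ` ?U)" using bounded_translation[OF \<phi>(2), of "- a"] by simp
  qed
  have ne: "\<phi> z \<noteq> a" if "z \<in> ?U" for z using a that by blast
  show ?thesis
  proof (cases "a \<in> frontier (\<phi> ` ?U)")
    case False
    hence "a \<notin> closure (\<phi> ` ?U)"
      using a closure_Un_frontier[of "\<phi> ` ?U"] by blast
    then obtain d where d: "d > 0" "\<And>w. w \<in> closure (\<phi> ` ?U) \<Longrightarrow> d \<le> dist a w"
      using separate_point_closed[of "closure (\<phi> ` ?U)" a] by auto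
    have far: "d \<le> cmod (\<phi> z - a)" if "z \<in> ?U" for z
      using d(2)[of "\<phi> z"] closure_subset[of "\<phi> ` ?U"] imageI[OF that, of \<phi>]
      unfolding dist_norm norm_minus_commute[of a] by blast
    define F where "F z = 1 / (\<phi> z - a)" for z
    have FG: "F z * (\<phi> z - a) = 1" if "z \<in> ?U" for z
      using ne[OF that] by (simp add: F_def)
    have "cmod (F z) \<le> 1 / d" if "z \<in> ?U" for z
      using far[OF that] d(1) by (auto simp: F_def norm_divide intro!: divide_left_mono mult_pos_pos)
    hence bF: "bounded (F ` ?U)" unfolding bounded_iff by blast
    show ?thesis
    proof (rule functional_vanishes_of_multipliers[OF R f kill, of "\<lambda>_. F" 1 "1/2"])
      show "F holomorphic_on ?U" unfolding F_def using ne by (intro holomorphic_intros \<phi>) auto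
      have "F z * (\<phi> z - a) = 1" if "z \<in> ball 0 (1/2)" for z using FG that by simp
      thus "uniform_limit (ball 0 (1/2)) (\<lambda>j z. F z * (\<phi> z - a)) (\<lambda>_. 1) sequentially"
        by (auto simp: uniform_limit_iff)
    qed (use bF FG in auto)
  next
    case True
    from K[OF this] obtain K y where K: "compact K" "connected K" "\<phi> ` ?U \<inter> K = {}" "a \<in> K" "y \<in> K" "y \<noteq> a"
      unfolding nondegenerate_continuum_def by metis
    have "compact (\<phi> ` cball 0 (1/2))"
      by (intro compact_continuous_image continuous_on_subset[OF holomorphic_on_imp_continuous_on[OF \<phi>(1)]]) auto
    moreover have "a \<notin> \<phi> ` cball 0 (1/2)"
      using a image_mono[of "cball 0 (1/2)" ?U \<phi>] by fastforce
    ultimately obtain d where d: "d > 0" "\<And>w. w \<in> \<phi> ` cball 0 (1/2) \<Longrightarrow> d \<le> dist a w"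
      using separate_point_closed[of "\<phi> ` cball 0 (1/2)" a] compact_imp_closed by metis
    (* The factor 4 below provides both 3 delta < dist a (phi 0) and delta <= d / 2. *)
    define e where "e = min d (dist a y)"
    have e: "e > 0" "e \<le> d" "e \<le> dist a y" using d(1) K(6) by (auto simp: e_def)
    define \<delta> where "\<delta> j = e / 4 / real (Suc j)" for j
    have \<delta>: "\<delta> j > 0" "\<delta> j \<le> e / 4" for j
    proof -
      show "\<delta> j > 0" using e(1) by (simp add: \<delta>_def)
      have "e / 4 / real (Suc j) \<le> e / 4 / 1" using e(1) by (intro divide_left_mono) auto
      thus "\<delta> j \<le> e / 4" by (simp add: \<delta>_def)
    qed
    have "\<exists>F. F holomorphic_on ?U \<and> bounded (F ` ?U) \<and>
        (\<forall>z\<in>?U. cmod (F z * (\<phi> z - a)) \<le> 144) \<and>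
        (\<forall>z\<in>?U. cmod (F z * (\<phi> z - a) - 1) * (dist (\<phi> z) a - \<delta> j) \<le> 325 * \<delta> j)" for j
    proof -
      have "d \<le> dist a (\<phi> 0)" using d(2)[of "\<phi> 0"] by auto
      hence "\<delta> j < dist a y" "3 * \<delta> j < dist a (\<phi> 0)" using \<delta>[of j] e by linarith+
      from koebe_multiplier[OF \<phi>(1) K(1-5) \<delta>(1) this] show ?thesis by metis
    qed
    then obtain F where F: "\<And>j. F j holomorphic_on ?U" "\<And>j. bounded (F j ` ?U)"
        "\<And>j z. z \<in> ?U \<Longrightarrow> cmod (F j z * (\<phi> z - a)) \<le> 144"
        "\<And>j z. z \<in> ?U \<Longrightarrow> cmod (F j z * (\<phi> z - a) - 1) * (dist (\<phi> z) a - \<delta> j) \<le> 325 * \<delta> j"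
      by metis
    have close: "cmod (F j z * (\<phi> z - a) - 1) \<le> 650 / d * \<delta> j" if "z \<in> ball 0 (1/2)" for j z
    proof -
      have "d \<le> dist a (\<phi> z)" using d(2)[of "\<phi> z"] that by auto
      hence "d / 2 \<le> dist (\<phi> z) a - \<delta> j" using \<delta>[of j] e by (simp add: dist_commute)
      hence "cmod (F j z * (\<phi> z - a) - 1) * (d / 2) \<le> cmod (F j z * (\<phi> z - a) - 1) * (dist (\<phi> z) a - \<delta> j)"
        by (intro mult_left_mono) auto
      also have "\<dots> \<le> 325 * \<delta> j" using F(4)[of z j] that by simp
      finally show ?thesis using d(1) by (simp add: field_simps)
    qed
    have lim0: "(\<lambda>j. 650 / d * \<delta> j) \<longlonglongrightarrow> 0"
      unfolding \<delta>_def by (intro tendsto_mult_right_zero tendsto_divide_0[OF tendsto_const]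
          filterlim_at_top_imp_at_infinity filterlim_compose[OF filterlim_real_sequentially filterlim_Suc])
    have "uniform_limit (ball 0 (1/2)) (\<lambda>j z. F j z * (\<phi> z - a)) (\<lambda>_. 1) sequentially"
    proof (rule uniform_limitI)
      fix \<epsilon> :: real assume "\<epsilon> > 0"
      hence "eventually (\<lambda>j. 650 / d * \<delta> j < \<epsilon>) sequentially"
        using order_tendstoD(2)[OF lim0] by blast
      thus "eventually (\<lambda>j. \<forall>z\<in>ball 0 (1/2). dist (F j z * (\<phi> z - a)) 1 < \<epsilon>) sequentially"
      proof eventually_elim
        case (elim j)
        show ?case
        proof
          fix z :: complex assume "z \<in> ball 0 (1/2)"
          from close[OF this, of j] elim show "dist (F j z * (\<phi> z - a)) 1 < \<epsilon>"
            unfolding dist_norm by (rule le_less_trans)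
        qed
      qed
    qed
    thus ?thesis
      by (intro functional_vanishes_of_multipliers[OF R f kill F(1,2,3), of "1/2"]) auto
  qed
qed

section \<open>Weighted composition operators\<close>

text \<open>
  Littlewood's argument for the boundedness of composition operators.  Writing a polynomial as
  \<open>p(0) + z q\<close> gives \<open>k (p \<circ> \<omega>) = p(0) k + \<omega> (k (q \<circ> \<omega>))\<close>.  The two summands are orthogonal when \<open>k\<close> is the
  kernel at a zero of \<open>\<omega>\<close>, and multiplication by \<open>\<omega>\<close> is a contraction.
\<close>

lemma weighted_composition_polynomial:
  assumes \<omega>: "\<omega> holomorphic_on ball 0 1" "\<omega> ` ball 0 1 \<subseteq> ball 0 1"
    and z0: "z0 \<in> ball 0 1" "\<omega> z0 = 0"
  shows "\<exists>f. (\<forall>z\<in>ball 0 1. hardy2_fun f z = hardy2_fun (hardy2_kernel z0) z * (\<Sum>n<N. a n * \<omega> z ^ n)) \<and>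
             (norm f)\<^sup>2 \<le> (norm (hardy2_kernel z0))\<^sup>2 * (\<Sum>n<N. (cmod (a n))\<^sup>2)"
proof (induction N arbitrary: a)
  case 0
  show ?case by (intro exI[of _ 0]) (simp add: zero_hardy2.rep_eq)
next
  case (Suc N)
  let ?k = "hardy2_kernel z0"
  have b: "bounded (\<omega> ` ball 0 1)" using \<omega>(2) bounded_subset bounded_ball by blast
  note T = hardy2_fun_toeplitz[OF \<omega>(1) b]
  from Suc.IH[of "\<lambda>n. a (Suc n)"] obtain g where
    g: "\<And>z. z \<in> ball 0 1 \<Longrightarrow> hardy2_fun g z = hardy2_fun ?k z * (\<Sum>n<N. a (Suc n) * \<omega> z ^ n)"
       "(norm g)\<^sup>2 \<le> (norm ?k)\<^sup>2 * (\<Sum>n<N. (cmod (a (Suc n)))\<^sup>2)"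
    by blast
  define f where "f = toeplitz \<omega> g + a 0 *\<^sub>C ?k"
  show ?case
  proof (intro exI[of _ f] conjI ballI)
    fix z :: complex assume z: "z \<in> ball 0 1"
    show "hardy2_fun f z = hardy2_fun ?k z * (\<Sum>n<Suc N. a n * \<omega> z ^ n)"
      by (simp add: f_def hardy2_fun_add hardy2_fun_scaleC T[OF z] g(1)[OF z] sum.lessThan_Suc_shift
          sum_distrib_left algebra_simps del: sum.lessThan_Suc)
  next
    have "inner (toeplitz \<omega> g) (a 0 *\<^sub>C ?k) = 0"
      by (simp add: inner_scaleC_kernel[OF z0(1)] T[OF z0(1)] z0(2))
    hence "(norm f)\<^sup>2 = (norm (toeplitz \<omega> g))\<^sup>2 + (norm (a 0 *\<^sub>C ?k))\<^sup>2"
      by (simp add: f_def power2_norm_eq_inner inner_add_left inner_add_right inner_commute)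
    also have "(norm (toeplitz \<omega> g))\<^sup>2 \<le> (norm g)\<^sup>2"
    proof (intro power_mono)
      have "cmod (\<omega> z) \<le> 1" if "z \<in> ball 0 1" for z using \<omega>(2) that by force
      from toeplitz_norm_le[OF \<omega>(1) this] show "norm (toeplitz \<omega> g) \<le> norm g" by simp
    qed simp
    also note g(2)
    finally show "(norm f)\<^sup>2 \<le> (norm ?k)\<^sup>2 * (\<Sum>n<Suc N. (cmod (a n))\<^sup>2)"
      by (simp add: norm_scaleC power_mult_distrib sum.lessThan_Suc_shift algebra_simps
          del: sum.lessThan_Suc)
  qed
qed

text \<open>
  The polynomial estimate, applied to differences of Taylor polynomials of \<open>h\<close>, shows that their
  images form a Cauchy sequence; point evaluations identify its limit.
\<close>

lemma weighted_composition_exists: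
  assumes \<omega>: "\<omega> holomorphic_on ball 0 1" "\<omega> ` ball 0 1 \<subseteq> ball 0 1"
    and z0: "z0 \<in> ball 0 1" "\<omega> z0 = 0"
  shows "\<exists>f. (\<forall>z\<in>ball 0 1. hardy2_fun f z = hardy2_fun (hardy2_kernel z0) z * hardy2_fun h (\<omega> z)) \<and>
             norm f \<le> norm h * norm (hardy2_kernel z0)"
proof -
  let ?k = "hardy2_kernel z0"
  let ?a = "hardy2_coeff h"
  define S where "S N = (\<Sum>n<N. (cmod (?a n))\<^sup>2)" for N
  note poly = weighted_composition_polynomial[OF \<omega> z0]
  have "\<exists>f. \<forall>N. (\<forall>z\<in>ball 0 1. hardy2_fun (f N) z = hardy2_fun ?k z * (\<Sum>n<N. ?a n * \<omega> z ^ n)) \<and>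
      (norm (f N))\<^sup>2 \<le> (norm ?k)\<^sup>2 * S N"
    using poly[where a = ?a] unfolding S_def by (intro choice) auto
  then obtain f where
    f: "\<And>N z. z \<in> ball 0 1 \<Longrightarrow> hardy2_fun (f N) z = hardy2_fun ?k z * (\<Sum>n<N. ?a n * \<omega> z ^ n)"
    and fn: "\<And>N. (norm (f N))\<^sup>2 \<le> (norm ?k)\<^sup>2 * S N"
    by blast
  have diff: "(norm (f N - f M))\<^sup>2 \<le> (norm ?k)\<^sup>2 * (S N - S M)" if "M \<le> N" for M N
  proof -
    have split: "(\<Sum>n<N. x n) = (\<Sum>n<M. x n) + (\<Sum>n<N. if n < M then 0 else x n)"
      for x :: "nat \<Rightarrow> 'b::comm_monoid_add"
    proof -
      have "(\<Sum>n<N. x n) = (\<Sum>n<N. (if n < M then x n else 0) + (if n < M then 0 else x n))"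
        by (intro sum.cong) auto
      also have "\<dots> = (\<Sum>n<N. if n < M then x n else 0) + (\<Sum>n<N. if n < M then 0 else x n)"
        by (rule sum.distrib)
      also have "(\<Sum>n<N. if n < M then x n else 0) = (\<Sum>n<M. x n)"
        using that by (intro sum.mono_neutral_cong_right) auto
      finally show ?thesis .
    qed
    obtain g where
      g: "\<And>z. z \<in> ball 0 1 \<Longrightarrow>
            hardy2_fun g z = hardy2_fun ?k z * (\<Sum>n<N. (if n < M then 0 else ?a n) * \<omega> z ^ n)"
         "(norm g)\<^sup>2 \<le> (norm ?k)\<^sup>2 * (\<Sum>n<N. (cmod (if n < M then 0 else ?a n))\<^sup>2)"
      using poly[where N = N and a = "\<lambda>n. if n < M then 0 else ?a n"] by blast
    have "f N - f M = g"
    proof (rule hardy2_eqI)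
      fix z :: complex assume z: "z \<in> ball 0 1"
      have "(\<Sum>n<N. (if n < M then 0 else ?a n) * \<omega> z ^ n) = (\<Sum>n<N. if n < M then 0 else ?a n * \<omega> z ^ n)"
        by (intro sum.cong) auto
      thus "hardy2_fun (f N - f M) z = hardy2_fun g z"
        by (simp only: hardy2_fun_diff f[OF z] g(1)[OF z] split[of "\<lambda>n. ?a n * \<omega> z ^ n"]
            distrib_left add_diff_cancel_left')
    qed
    moreover have "(\<Sum>n<N. (cmod (if n < M then 0 else ?a n))\<^sup>2) = S N - S M"
    proof -
      have "(\<Sum>n<N. (cmod (if n < M then 0 else ?a n))\<^sup>2) = (\<Sum>n<N. if n < M then 0 else (cmod (?a n))\<^sup>2)"
        by (intro sum.cong) auto
      thus ?thesis
        by (simp only: S_def split[of "\<lambda>n. (cmod (?a n))\<^sup>2"] add_diff_cancel_left')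
    qed
    ultimately show ?thesis using g(2) by simp
  qed
  have "S \<longlonglongrightarrow> (norm h)\<^sup>2"
    using hardy2_norm_sums[of h] unfolding sums_def S_def .
  hence CS: "Cauchy S" by (simp add: LIMSEQ_imp_Cauchy)
  have "Cauchy f"
  proof (rule metric_CauchyI)
    fix e :: real assume e: "e > 0"
    define c where "c = (norm ?k)\<^sup>2 + 1"
    have c: "c > 0" by (simp add: c_def add_nonneg_pos)
    obtain J where J: "\<And>m n. m \<ge> J \<Longrightarrow> n \<ge> J \<Longrightarrow> dist (S m) (S n) < e\<^sup>2 / c"
      using metric_CauchyD[OF CS, of "e\<^sup>2 / c"] e c by auto
    have *: "dist (f n) (f m) < e" if "m \<ge> J" "m \<le> n" for m n
    proof -
      have d: "0 \<le> S n - S m"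
        using that unfolding S_def by (simp add: sum_mono2)
      have "(norm (f n - f m))\<^sup>2 \<le> (norm ?k)\<^sup>2 * (S n - S m)" using diff that by simp
      also have "\<dots> \<le> c * (S n - S m)" using d by (intro mult_right_mono) (simp_all add: c_def)
      also have "S n - S m < e\<^sup>2 / c"
        using J[of n m] that by (simp add: dist_real_def)
      hence "c * (S n - S m) < e\<^sup>2" using c by (simp add: field_simps)
      finally show ?thesis
        unfolding dist_norm by (rule power_less_imp_less_base) (use e in simp)
    qed
    show "\<exists>J. \<forall>m\<ge>J. \<forall>n\<ge>J. dist (f m) (f n) < e"
    proof (intro exI[of _ J] allI impI)
      fix m n assume "m \<ge> J" "n \<ge> J"
      thus "dist (f m) (f n) < e"
        using *[of m n] *[of n m] by (cases "m \<le> n") (auto simp: dist_commute)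
    qed
  qed
  then obtain L where L: "f \<longlonglongrightarrow> L"
    by (auto simp: Cauchy_convergent_iff convergent_def)
  show ?thesis
  proof (intro exI[of _ L] conjI ballI)
    fix z :: complex assume z: "z \<in> ball 0 1"
    have "\<omega> z \<in> ball 0 1" using \<omega>(2) z by blast
    hence "(\<lambda>N. \<Sum>n<N. ?a n * \<omega> z ^ n) \<longlonglongrightarrow> hardy2_fun h (\<omega> z)"
      using hardy2_sums[of "\<omega> z" h] by (simp add: sums_def)
    hence "(\<lambda>N. hardy2_fun (f N) z) \<longlonglongrightarrow> hardy2_fun ?k z * hardy2_fun h (\<omega> z)"
      unfolding f[OF z] by (intro tendsto_intros)
    thus "hardy2_fun L z = hardy2_fun ?k z * hardy2_fun h (\<omega> z)"
      using hardy2_fun_tendsto[OF L z] LIMSEQ_unique by blast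
  next
    have "norm (f N) \<le> norm h * norm ?k" for N
    proof (rule power2_le_imp_le)
      have "S N \<le> (norm h)\<^sup>2"
        unfolding S_def by (rule hardy2_partial_sum_le)
      hence "(norm (f N))\<^sup>2 \<le> (norm ?k)\<^sup>2 * (norm h)\<^sup>2"
        by (intro order_trans[OF fn[of N]] mult_left_mono) auto
      thus "(norm (f N))\<^sup>2 \<le> (norm h * norm ?k)\<^sup>2" by (simp add: power_mult_distrib mult.commute)
    qed simp
    thus "norm L \<le> norm h * norm ?k"
      by (intro Lim_norm_ubound[OF _ L]) auto
  qed
qed

lemma weighted_composition_operator:
  assumes \<omega>: "\<omega> holomorphic_on ball 0 1" "\<omega> ` ball 0 1 \<subseteq> ball 0 1"
    and z0: "z0 \<in> ball 0 1" "\<omega> z0 = 0"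
  obtains X where "bounded_clinear X"
    "\<And>h z. z \<in> ball 0 1 \<Longrightarrow> hardy2_fun (X h) z = hardy2_fun (hardy2_kernel z0) z * hardy2_fun h (\<omega> z)"
proof -
  obtain X where
    X: "\<And>h z. z \<in> ball 0 1 \<Longrightarrow> hardy2_fun (X h) z = hardy2_fun (hardy2_kernel z0) z * hardy2_fun h (\<omega> z)"
    and n: "\<And>h. norm (X h) \<le> norm h * norm (hardy2_kernel z0)"
    using weighted_composition_exists[OF \<omega> z0] by metis
  have "bounded_linear X"
    by (rule bounded_linear_intro[OF _ _ n])
       (rule hardy2_eqI; simp add: X hardy2_fun_add hardy2_fun_scaleR algebra_simps)+
  moreover have "X (c *\<^sub>C h) = c *\<^sub>C X h" for c h
    by (rule hardy2_eqI) (simp add: X hardy2_fun_scaleC)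
  ultimately have "bounded_clinear X" by (simp add: bounded_clinear_def)
  thus ?thesis using X that by blast
qed

lemma bounded_clinear_compose:
  assumes "bounded_clinear X" "bounded_clinear Y"
  shows "bounded_clinear (Y \<circ> X)"
  using assms bounded_linear_compose[of Y X] unfolding bounded_clinear_def by (auto simp: comp_def)

text \<open>
  Formally the intertwiner is \<open>h \<mapsto> h \<circ> \<omega>\<close>.  To have weights for which boundedness is elementary, \<open>\<omega>\<close> is
  factored as a disc automorphism \<open>?s\<close> after a self-map \<open>?t \<circ> \<omega>\<close> of the disc that fixes \<open>0\<close>.  Both factors have a zero in the
  disc, whereas \<open>\<omega>\<close> itself need not have one.
\<close>

lemma subordinate_imp_intertwines:
  assumes \<phi>: "\<phi> holomorphic_on ball 0 1" "bounded (\<phi> ` ball 0 1)"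
    and \<psi>: "\<psi> holomorphic_on ball 0 1" "bounded (\<psi> ` ball 0 1)"
    and \<omega>: "\<omega> holomorphic_on ball 0 1" "\<omega> ` ball 0 1 \<subseteq> ball 0 1"
    and eq: "\<And>z. z \<in> ball 0 1 \<Longrightarrow> \<phi> (\<omega> z) = \<psi> z"
  shows "toeplitz \<phi> \<propto> toeplitz \<psi>"
proof -
  let ?U = "ball 0 1 :: complex set"
  define a where "a = \<omega> 0"
  have a: "cmod a < 1" using \<omega>(2) imageI[of 0 "ball 0 1" \<omega>] by (simp add: a_def subset_iff)
  let ?t = "Moebius_function 0 a" and ?s = "Moebius_function 0 (- a)"
  have s: "?s holomorphic_on ?U" "?s ` ?U \<subseteq> ?U" "- a \<in> ?U" "?s (- a) = 0"
    using a by (auto simp: Moebius_function_norm_lt_1 Moebius_function_eq_zero intro!: Moebius_function_holomorphic)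
  have t: "(?t \<circ> \<omega>) holomorphic_on ?U" "(?t \<circ> \<omega>) ` ?U \<subseteq> ?U" "0 \<in> ?U" "(?t \<circ> \<omega>) 0 = 0"
    using a \<omega> by (auto simp: Moebius_function_eq_zero simp flip: a_def
        intro!: holomorphic_on_compose_gen[OF \<omega>(1) Moebius_function_holomorphic] Moebius_function_norm_lt_1)
  have st: "?s (?t w) = w" if "w \<in> ?U" for w
    using Moebius_function_compose[of "- a" a w] a that by simp
  obtain X where X: "bounded_clinear X"
    "\<And>h z. z \<in> ?U \<Longrightarrow> hardy2_fun (X h) z = hardy2_fun (hardy2_kernel (- a)) z * hardy2_fun h (?s z)"
    using weighted_composition_operator[OF s] by metis
  obtain Y where Y: "bounded_clinear Y"
    "\<And>h z. z \<in> ?U \<Longrightarrow> hardy2_fun (Y h) z = hardy2_fun (hardy2_kernel 0) z * hardy2_fun h ((?t \<circ> \<omega>) z)"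
    using weighted_composition_operator[OF t] by metis
  have YX: "hardy2_fun (Y (X h)) z =
      hardy2_fun (hardy2_kernel 0) z * hardy2_fun (hardy2_kernel (- a)) (?t (\<omega> z)) * hardy2_fun h (\<omega> z)"
    if z: "z \<in> ?U" for h z
  proof -
    have "\<omega> z \<in> ?U" "?t (\<omega> z) \<in> ?U" using \<omega>(2) t(2) z unfolding image_subset_iff comp_apply by blast+
    thus ?thesis using z by (simp add: Y(2) X(2) st)
  qed
  have "Y \<circ> X \<noteq> (\<lambda>_. 0)"
  proof
    assume zero: "Y \<circ> X = (\<lambda>_. 0)"
    have k0: "hardy2_fun (hardy2_kernel w) 0 = 1" if "w \<in> ?U" for w
      using that by (simp add: hardy2_fun_at_0 hardy2_coeff_kernel)
    have "?t a = 0" by (rule Moebius_function_eq_zero)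
    moreover have "hardy2_fun (Y (X (hardy2_kernel a))) 0 = 0"
      using fun_cong[OF zero, of "hardy2_kernel a"] by (simp add: zero_hardy2.rep_eq)
    ultimately have "hardy2_fun (hardy2_kernel a) a = 0"
      using YX[of 0 "hardy2_kernel a"] k0[of 0] k0[of "- a"] a by (simp flip: a_def)
    hence "hardy2_kernel a = 0"
      using inner_kernel[of a "hardy2_kernel a"] a by simp
    thus False using k0[of a] a by (simp add: zero_hardy2.rep_eq)
  qed
  moreover have "(Y \<circ> X) \<circ> toeplitz \<phi> = toeplitz \<psi> \<circ> (Y \<circ> X)"
  proof (rule ext, rule hardy2_eqI)
    fix h and z :: complex assume z: "z \<in> ?U"
    have "\<omega> z \<in> ?U" using \<omega>(2) z by blast
    thus "hardy2_fun (((Y \<circ> X) \<circ> toeplitz \<phi>) h) z = hardy2_fun ((toeplitz \<psi> \<circ> (Y \<circ> X)) h) z"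
      using hardy2_fun_toeplitz[OF \<phi>, of "\<omega> z" h] hardy2_fun_toeplitz[OF \<psi> z, of "Y (X h)"] eq[OF z]
      by (simp only: comp_apply YX[OF z] mult_ac)
  qed
  ultimately show ?thesis
    unfolding intertwines_def using bounded_clinear_compose[OF X(1) Y(1)] by blast
qed

section \<open>Intertwining and the inclusion of ranges\<close>

text \<open>
  Evaluating an intertwiner at \<open>w\<close> gives a functional under which multiplication by \<open>\<phi>\<close> becomes
  multiplication by the number \<open>\<psi> w\<close>.  It annihilates \<open>(\<phi> - \<psi> w) H\<^sup>2\<close>, which is dense.  Its real part
  suffices, because \<open>h\<close> may be replaced by \<open>\<i> h\<close>.
\<close>

lemma intertwiner_vanishes_off_range:
  assumes \<phi>: "\<phi> holomorphic_on ball 0 1" "bounded (\<phi> ` ball 0 1)"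
    and \<psi>: "\<psi> holomorphic_on ball 0 1" "bounded (\<psi> ` ball 0 1)"
    and X: "bounded_clinear X" "X \<circ> toeplitz \<phi> = toeplitz \<psi> \<circ> X"
    and w: "w \<in> ball 0 1" "\<psi> w \<notin> \<phi> ` ball 0 1"
    and K: "\<psi> w \<in> frontier (\<phi> ` ball 0 1) \<Longrightarrow>
      \<exists>K. nondegenerate_continuum K \<and> \<psi> w \<in> K \<and> \<phi> ` ball 0 1 \<inter> K = {}"
  shows "hardy2_fun (X h) w = 0"
proof -
  have Xl: "bounded_linear X" and Xc: "X (c *\<^sub>C f) = c *\<^sub>C X f" for c f
    using X(1) by (auto simp: bounded_clinear_def)
  interpret X: bounded_linear X by (rule Xl)
  have Re0: "Re (hardy2_fun (X f) w) = 0" for f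
  proof -
    define R where "R f = inner (X f) (hardy2_kernel w)" for f
    have R: "R f = Re (hardy2_fun (X f) w)" for f
      unfolding R_def by (rule inner_kernel[OF w(1)])
    have "bounded_linear R"
      unfolding R_def by (rule bounded_linear_compose[OF bounded_linear_inner_left Xl])
    moreover have "R (toeplitz (\<lambda>z. \<phi> z - \<psi> w) f) = 0" for f
    proof -
      have f': "(\<lambda>z. \<phi> z - \<psi> w) holomorphic_on ball 0 1" by (intro holomorphic_intros \<phi>)
      have "(\<lambda>z. \<phi> z - \<psi> w) ` ball 0 1 = (\<lambda>v. - \<psi> w + v) ` \<phi> ` ball 0 1" by (auto simp: image_image)
      hence b': "bounded ((\<lambda>z. \<phi> z - \<psi> w) ` ball 0 1)"
        using bounded_translation[OF \<phi>(2), of "- \<psi> w"] by simp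
      have "toeplitz (\<lambda>z. \<phi> z - \<psi> w) f = toeplitz \<phi> f - \<psi> w *\<^sub>C f"
        by (rule hardy2_eqI)
           (simp add: hardy2_fun_diff hardy2_fun_scaleC hardy2_fun_toeplitz[OF f' b'] hardy2_fun_toeplitz[OF \<phi>]
              left_diff_distrib)
      hence "X (toeplitz (\<lambda>z. \<phi> z - \<psi> w) f) = toeplitz \<psi> (X f) - \<psi> w *\<^sub>C X f"
        using fun_cong[OF X(2), of f] by (simp add: X.diff Xc)
      thus ?thesis
        by (simp add: R hardy2_fun_diff hardy2_fun_scaleC hardy2_fun_toeplitz[OF \<psi> w(1)])
    qed
    ultimately have "R f = 0"
      using toeplitz_range_annihilator_zero[OF \<phi> w(2) K, of R] by blast
    thus ?thesis by (simp add: R)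
  qed
  have "Im (hardy2_fun (X h) w) = 0"
    using Re0[of "\<i> *\<^sub>C h"] by (simp add: Xc hardy2_fun_scaleC)
  with Re0[of h] show ?thesis by (simp add: complex_eq_iff)
qed

theorem corollary3p5:
  fixes \<phi> \<psi> :: "complex \<Rightarrow> complex"
  assumes "\<phi> holomorphic_on ball 0 1" and "bounded (\<phi> ` ball 0 1)"
    and "\<psi> holomorphic_on ball 0 1" and "bounded (\<psi> ` ball 0 1)"
    and "covering_space (ball 0 1) \<phi> (\<phi> ` ball 0 1)"
    and "\<exists>\<C>. (\<forall>K\<in>\<C>. nondegenerate_continuum K) \<and> frontier (\<phi> ` ball 0 1) = \<Union>\<C>"
  shows "toeplitz \<phi> \<propto> toeplitz \<psi> \<longleftrightarrow> \<psi> ` ball 0 1 \<subseteq> \<phi> ` ball 0 1"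
proof
  let ?U = "ball 0 1 :: complex set"
  assume sub: "\<psi> ` ?U \<subseteq> \<phi> ` ?U"
  obtain \<omega> where "\<omega> holomorphic_on ?U" "\<omega> \<in> ?U \<rightarrow> ?U" "\<And>z. z \<in> ?U \<Longrightarrow> \<phi> (\<omega> z) = \<psi> z"
    by (rule covering_space_lift_holomorphic[OF assms(5) open_ball assms(1,3)])
       (use sub in \<open>auto intro!: convex_imp_simply_connected convex_imp_locally_path_connected\<close>)
  thus "toeplitz \<phi> \<propto> toeplitz \<psi>"
    by (intro subordinate_imp_intertwines[OF assms(1-4), of \<omega>]) auto
next
  let ?U = "ball 0 1 :: complex set"
  assume "toeplitz \<phi> \<propto> toeplitz \<psi>"
  then obtain X where X: "bounded_clinear X" "X \<noteq> (\<lambda>_. 0)" "X \<circ> toeplitz \<phi> = toeplitz \<psi> \<circ> X"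
    unfolding intertwines_def by blast
  have cont: "\<exists>K. nondegenerate_continuum K \<and> a \<in> K \<and> K \<subseteq> frontier (\<phi> ` ?U)"
    if "a \<in> frontier (\<phi> ` ?U)" for a
    using assms(6) that by blast
  have "open (\<phi> ` ?U)"
  proof (rule open_mapping_thm[OF assms(1)])
    show "\<not> \<phi> constant_on ?U"
    proof
      assume "\<phi> constant_on ?U"
      then obtain c where "\<And>z. z \<in> ?U \<Longrightarrow> \<phi> z = c" unfolding constant_on_def by blast
      hence "\<phi> ` ?U = (\<lambda>_. c) ` ?U" by (intro image_cong) auto
      hence "\<phi> ` ?U = {c}" by (simp add: image_constant_conv)
      hence fr: "frontier (\<phi> ` ?U) = {c}" by (simp add: frontier_def)
      then obtain K where "nondegenerate_continuum K" "K \<subseteq> {c}" using cont[of c] by auto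
      thus False unfolding nondegenerate_continuum_def by blast
    qed
  qed auto
  hence disj: "\<phi> ` ?U \<inter> frontier (\<phi> ` ?U) = {}"
    by (auto simp: frontier_def interior_open)
  obtain h where h: "X h \<noteq> 0" using X(2) by auto
  then obtain b where b: "b \<in> ?U" "hardy2_fun (X h) b \<noteq> 0"
    using hardy2_eqI[of "X h" 0] by (auto simp: zero_hardy2.rep_eq)
  have hit: "\<psi> w \<in> \<phi> ` ?U" if w: "w \<in> ?U" "hardy2_fun (X h) w \<noteq> 0" for w
  proof (rule ccontr)
    assume "\<psi> w \<notin> \<phi> ` ?U"
    moreover have "\<exists>K. nondegenerate_continuum K \<and> \<psi> w \<in> K \<and> \<phi> ` ?U \<inter> K = {}"
      if "\<psi> w \<in> frontier (\<phi> ` ?U)"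
      using cont[OF that] disj by blast
    ultimately have "hardy2_fun (X h) w = 0"
      using intertwiner_vanishes_off_range[OF assms(1-4) X(1,3) w(1)] by blast
    with w(2) show False by contradiction
  qed
  show "\<psi> ` ?U \<subseteq> \<phi> ` ?U"
  proof (rule image_subsetI, rule ccontr)
    fix w assume w: "w \<in> ?U" and no: "\<psi> w \<notin> \<phi> ` ?U"
    hence "hardy2_fun (X h) w = 0" using hit by blast
    then obtain r where r: "r > 0" "ball w r \<subseteq> ?U"
        "\<And>z. z \<in> ball w r - {w} \<Longrightarrow> hardy2_fun (X h) z \<noteq> 0"
      using isolated_zeros[OF hardy2_fun_holomorphic open_ball _ w _ b] by auto
    have near: "\<psi> ` ball w r \<subseteq> insert (\<psi> w) (\<phi> ` ?U)"
      using hit r by blast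
    have "\<not> \<psi> constant_on ?U"
      using hit[OF b] no w b(1) unfolding constant_on_def by metis
    hence "open (\<psi> ` ball w r)"
      using r(2) by (intro open_mapping_thm[OF assms(3)]) auto
    moreover have "\<psi> w \<in> \<psi> ` ball w r" using r(1) by simp
    ultimately have nh: "open (\<psi> ` ball w r)" "\<psi> w \<in> \<psi> ` ball w r" by auto
    have "\<psi> w \<in> closure (\<phi> ` ?U)"
    proof -
      have "\<psi> w islimpt \<psi> ` ball w r"
        using nh by (simp add: interior_limit_point interior_open)
      hence "\<psi> w islimpt \<phi> ` ?U"
        using near islimpt_subset islimpt_insert by blast
      thus ?thesis by (simp add: closure_def)
    qed
    hence "\<psi> w \<in> frontier (\<phi> ` ?U)"
      using no interior_subset by (auto simp: frontier_def)
    from cont[OF this] obtain K where K: "nondegenerate_continuum K" "\<psi> w \<in> K" "K \<subseteq> frontier (\<phi> ` ?U)"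
      by blast
    (* The boundary point psi w would be isolated in a nondegenerate connected set. *)
    have "K \<inter> \<psi> ` ball w r = {\<psi> w}"
      using near K(2,3) disj nh(2) by blast
    moreover have "\<psi> w islimpt K"
      using K(1,2) unfolding nondegenerate_continuum_def
      by (metis connected_imp_perfect singletonD)
    ultimately show False
      using nh by (metis (no_types, lifting) IntI islimptE singletonD)
  qed
qed

end
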